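(* Let $(C,o)$ be a reduced complex analytic curve singularity with $r$ irreducible branches, and let $\{S_n\}_{n\in\mathbb{Z}}$ be the sublevel-set cubical complexes of its weight function $w_0$, used to define the lattice cohomology $\mathbb{H}^*(C,o)$. Then $S_n$ is contractible for every $n>0$. Consequently, $\mathbb{H}^q_{\mathrm{red},2n}(C,o)=0$ for all $n>0$ and $q\ge 0$.
   Context: Let $(C,o)=\bigcup_{i=1}^r(C_i,o)$ be the decomposition into irreducible branches, $\mathcal{O}=\mathcal{O}_{C,o}$ the local ring, $n_i:(\mathbb{C},0)\to(C_i,o)$ the normalization of the $i$-th branch with parameter $t_i$, and $\mathfrak{v}_i(g)=\mathrm{ord}_{t_i}(n_i^*g)\in\mathbb{Z}_{\ge0}\cup\{\infty\}$ for $g\in\mathcal{O}$. For $\ell=(\ell_1,\dots,\ell_r)\in\mathbb{Z}_{\ge 0}^r$ put $\mathcal{F}(\ell)=\{g\in\mathcal{O}\mid \mathfrak{v}_i(g)\ge\ell_i\ \forall i\}$, $\mathfrak{h}(\ell)=\dim_{\mathbb{C}}\mathcal{O}/\mathcal{F}(\ell)$ and $w_0(\ell)=2\mathfrak{h}(\ell)-|\ell|$ with $|\ell|=\sum_i\ell_i$. $\mathbb{R}^r_{\ge0}$ is decomposed into closed unit cubes with vertices $\ell+\sum_{i\in K}e_i$, $K\subset I$ (for $\ell\in\mathbb{Z}_{\ge0}^r$, $I\subset\{1,\dots,r\}$; dimension $\#I\ge0$; $e_i$ the standard basis vectors). The weight of a cube is the maximum of $w_0$ over its vertices. $S_n\subset\mathbb{R}^r_{\ge0}$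 is the union of all closed cubes (of any dimension) of weight $\le n$; it is a finite cubical complex and $S_n\subset S_{n+1}$. The lattice cohomology is $\mathbb{H}^q_{2n}(C,o)=H^q(S_n,\mathbb{Z})$, and the reduced version is $\mathbb{H}^q_{\mathrm{red},2n}(C,o)=\widetilde H^q(S_n,\mathbb{Z})$ (reduced singular cohomology). *)

theory Defs
  imports
    "HOL-Complex_Analysis.Complex_Analysis"
    "HOL-Homology.Homology"
    "HOL-Algebra.QuotRing"
    "HOL-Algebra.Embedded_Algebras"
begin

section \<open>Analytic germs at the origin of \<open>\<complex>\<^sup>N\<close>\<close>

definition mholomorphic_on :: "(complex^'n \<Rightarrow> complex) \<Rightarrow> (complex^'n) set \<Rightarrow> bool" where
  "mholomorphic_on f U \<longleftrightarrow>
     (\<forall>x\<in>U. \<exists>f'. (f has_derivative f') (at x) \<and> (\<forall>c v. f' (c *s v) = c * f' v))"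

definition holo_at_0 :: "(complex^'n \<Rightarrow> complex) set" where
  "holo_at_0 = {f. \<exists>U. open U \<and> 0 \<in> U \<and> mholomorphic_on f U}"

text \<open>Subsets of \<open>\<complex>\<^sup>N\<close> stand for their germs at \<open>0\<close>; the base point \<open>o\<close> is \<open>0\<close>.\<close>

definition germ_le :: "(complex^'n) set \<Rightarrow> (complex^'n) set \<Rightarrow> bool" where
  "germ_le X Y \<longleftrightarrow> (\<forall>\<^sub>F x in nhds 0. x \<in> X \<longrightarrow> x \<in> Y)"

definition germ_eq :: "(complex^'n) set \<Rightarrow> (complex^'n) set \<Rightarrow> bool" where
  "germ_eq X Y \<longleftrightarrow> (\<forall>\<^sub>F x in nhds 0. x \<in> X \<longleftrightarrow> x \<in> Y)"

definition analytic_germ :: "(complex^'n) set \<Rightarrow> bool" where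
  "analytic_germ X \<longleftrightarrow>
     (\<exists>U F. open U \<and> 0 \<in> U \<and> finite F \<and> (\<forall>f\<in>F. mholomorphic_on f U) \<and>
            X \<inter> U = {x\<in>U. \<forall>f\<in>F. f x = 0})"

definition irreducible_germ :: "(complex^'n) set \<Rightarrow> bool" where
  "irreducible_germ X \<longleftrightarrow> analytic_germ X \<and> 0 \<in> X \<and>
     (\<forall>Y Z. analytic_germ Y \<longrightarrow> analytic_germ Z \<longrightarrow> germ_eq X (Y \<union> Z) \<longrightarrow>
            germ_eq X Y \<or> germ_eq X Z)"

definition irreducible_decomposition ::
  "(complex^'n) set \<Rightarrow> ('r::finite \<Rightarrow> (complex^'n) set) \<Rightarrow> bool" where
  "irreducible_decomposition C B \<longleftrightarrow>
     (\<forall>i. irreducible_germ (B i)) \<and> germ_eq C (\<Union>i. B i) \<and>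
     (\<forall>i j. i \<noteq> j \<longrightarrow> \<not> germ_le (B i) (B j))"

section \<open>The local ring of a reduced germ\<close>

text \<open>
  Functions agreeing near \<open>0\<close> are not identified in \<open>holo_ring\<close>; their difference lies in
  \<open>vanishing_ideal X\<close>, so that the quotient is \<open>\<O>\<^bsub>\<complex>\<^sup>N,0\<^esub> / I(X)\<close>. Taking the full
  vanishing ideal gives \<open>X\<close> its reduced structure.
\<close>

definition holo_ring :: "(complex^'n \<Rightarrow> complex) ring" where
  "holo_ring = \<lparr>carrier = holo_at_0, mult = (\<lambda>f g x. f x * g x), one = (\<lambda>x. 1),
                zero = (\<lambda>x. 0), add = (\<lambda>f g x. f x + g x)\<rparr>"

definition vanishing_ideal :: "(complex^'n) set \<Rightarrow> (complex^'n \<Rightarrow> complex) set" where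
  "vanishing_ideal X = {f \<in> holo_at_0. \<forall>\<^sub>F x in nhds 0. x \<in> X \<longrightarrow> f x = 0}"

definition local_ring :: "(complex^'n) set \<Rightarrow> (complex^'n \<Rightarrow> complex) set ring" where
  "local_ring X = holo_ring Quot vanishing_ideal X"

definition krull_dim :: "('a, 'b) ring_scheme \<Rightarrow> enat" where
  "krull_dim R = Sup {enat m | m. \<exists>P :: nat \<Rightarrow> 'a set.
     (\<forall>k\<le>m. primeideal (P k) R) \<and> (\<forall>k<m. P k \<subset> P (Suc k))}"

definition reduced_curve_germ :: "(complex^'n) set \<Rightarrow> bool" where
  "reduced_curve_germ C \<longleftrightarrow> analytic_germ C \<and> 0 \<in> C \<and> krull_dim (local_ring C) = 1"

section \<open>Normalization of a branch\<close>

text \<open>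
  \<open>\<complex>{t}\<close> is the set of convergent series in \<open>complex fps\<close>. The pullback along a parametrization
  whose image lies in \<open>X\<close> does not depend on the representative of an element of \<open>local_ring X\<close>.
\<close>

definition convergent_series :: "complex fps set" where
  "convergent_series = {F. fps_conv_radius F > 0}"

definition germ_pullback ::
  "(complex \<Rightarrow> complex^'n) \<Rightarrow> (complex^'n \<Rightarrow> complex) set \<Rightarrow> complex fps" where
  "germ_pullback \<nu> g = the_elem ((\<lambda>f. fps_expansion (f \<circ> \<nu>) 0) ` g)"

definition fractions :: "'k::field set \<Rightarrow> 'k set" where
  "fractions A = {a / b | a b. a \<in> A \<and> b \<in> A \<and> b \<noteq> 0}"

definition integral_over :: "'k::field set \<Rightarrow> 'k \<Rightarrow> bool" where
  "integral_over A q \<longleftrightarrow>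
     (\<exists>p :: 'k poly. lead_coeff p = 1 \<and> (\<forall>k. Polynomial.coeff p k \<in> A) \<and> poly p q = 0)"

text \<open>
  \<open>\<nu> : (\<complex>,0) \<rightarrow> (X,0)\<close> is a normalization: \<open>\<nu>\<^sup>*\<close> embeds the local ring of \<open>X\<close> into \<open>\<complex>{t}\<close>, and
  \<open>\<complex>{t}\<close> is the integral closure of the image in its field of fractions (formed inside the
  field of formal Laurent series).
\<close>

definition is_normalization :: "(complex^'n) set \<Rightarrow> (complex \<Rightarrow> complex^'n) \<Rightarrow> bool" where
  "is_normalization X \<nu> \<longleftrightarrow>
     (\<forall>k. (\<lambda>t. \<nu> t $ k) analytic_on {0}) \<and> \<nu> 0 = 0 \<and> (\<forall>\<^sub>F t in nhds 0. \<nu> t \<in> X) \<and>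
     inj_on (germ_pullback \<nu>) (carrier (local_ring X)) \<and>
     (let A = (\<lambda>g. fps_to_fls (germ_pullback \<nu> g)) ` carrier (local_ring X)
      in {q \<in> fractions A. integral_over A q} = fps_to_fls ` convergent_series)"

section \<open>The weight function\<close>

definition branch_val ::
  "(complex \<Rightarrow> complex^'n) \<Rightarrow> (complex^'n \<Rightarrow> complex) set \<Rightarrow> enat" where
  "branch_val \<nu> g =
     (if germ_pullback \<nu> g = 0 then \<infinity> else enat (subdegree (germ_pullback \<nu> g)))"

context
  fixes C :: "(complex^'n) set" and \<nu> :: "'r::finite \<Rightarrow> complex \<Rightarrow> complex^'n"
begin

definition val_ideal :: "nat^'r \<Rightarrow> (complex^'n \<Rightarrow> complex) set set" where
  "val_ideal l = {g \<in> carrier (local_ring C). \<forall>i. enat (l $ i) \<le> branch_val (\<nu> i) g}"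

text \<open>
  The vector space dimension is taken over the image of the constant functions in the
  quotient ring.
\<close>

definition hilbert :: "nat^'r \<Rightarrow> nat" where
  "hilbert l =
     (let Q = local_ring C Quot val_ideal l;
          K = range (\<lambda>c. val_ideal l +>\<^bsub>local_ring C\<^esub>
                            (vanishing_ideal C +>\<^bsub>holo_ring\<^esub> (\<lambda>x. c)))
      in ring.dim Q K (carrier Q))"

definition weight :: "nat^'r \<Rightarrow> int" where
  "weight l = 2 * int (hilbert l) - int (\<Sum>i\<in>UNIV. l $ i)"

definition vertex :: "nat^'r \<Rightarrow> 'r set \<Rightarrow> nat^'r" where
  "vertex l K = (\<chi> i. l $ i + (if i \<in> K then 1 else 0))"

definition cube :: "nat^'r \<Rightarrow> 'r set \<Rightarrow> (real^'r) set" where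
  "cube l I = cbox (\<chi> i. real (l $ i)) (\<chi> i. real (vertex l I $ i))"

definition cube_weight :: "nat^'r \<Rightarrow> 'r set \<Rightarrow> int" where
  "cube_weight l I = Max ((\<lambda>K. weight (vertex l K)) ` Pow I)"

definition sublevel :: "int \<Rightarrow> (real^'r) set" where
  "sublevel n = \<Union> {cube l I | l I. cube_weight l I \<le> n}"

end

section \<open>Reduced singular cohomology with integer coefficients\<close>

text \<open>
  The cohomology of the cochain complex \<open>Hom(C\<^sub>q, \<int>)\<close> augmented by
  \<open>\<int> \<rightarrow> Hom(C\<^sub>0, \<int>)\<close>, which sends \<open>m\<close> to \<open>m\<close> times the augmentation.
\<close>

definition cochain_group :: "nat \<Rightarrow> 'a topology \<Rightarrow> ('a chain \<Rightarrow> int) monoid" where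
  "cochain_group q X =
     \<lparr>carrier = hom (chain_group q X) integer_group \<inter> extensional (singular_chain_set q X),
      mult = (\<lambda>\<phi> \<psi>. restrict (\<lambda>c. \<phi> c + \<psi> c) (singular_chain_set q X)),
      one = restrict (\<lambda>c. 0) (singular_chain_set q X)\<rparr>"

definition coboundary :: "nat \<Rightarrow> 'a topology \<Rightarrow> ('a chain \<Rightarrow> int) \<Rightarrow> 'a chain \<Rightarrow> int" where
  "coboundary q X \<phi> =
     restrict (\<lambda>c. \<phi> (chain_boundary (Suc q) c)) (singular_chain_set (Suc q) X)"

definition augmentation :: "'a chain \<Rightarrow> int" where
  "augmentation c = (\<Sum>\<sigma>\<in>Poly_Mapping.keys c. Poly_Mapping.lookup c \<sigma>)"

definition cocycle_set :: "nat \<Rightarrow> 'a topology \<Rightarrow> ('a chain \<Rightarrow> int) set" where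
  "cocycle_set q X =
     {\<phi> \<in> carrier (cochain_group q X). coboundary q X \<phi> = \<one>\<^bsub>cochain_group (Suc q) X\<^esub>}"

definition reduced_coboundary_set :: "nat \<Rightarrow> 'a topology \<Rightarrow> ('a chain \<Rightarrow> int) set" where
  "reduced_coboundary_set q X =
     (case q of
        0 \<Rightarrow> range (\<lambda>m. restrict (\<lambda>c. m * augmentation c) (singular_chain_set 0 X))
      | Suc p \<Rightarrow> coboundary p X ` carrier (cochain_group p X))"

definition reduced_cohomology_group ::
  "nat \<Rightarrow> 'a topology \<Rightarrow> ('a chain \<Rightarrow> int) set monoid" where
  "reduced_cohomology_group q X =
     subgroup_generated (cochain_group q X) (cocycle_set q X) Mod reduced_coboundary_set q X"

text \<open>Degree \<open>2n\<close> of the reduced lattice cohomology, indexed by \<open>n\<close>.\<close>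

definition reduced_lattice_cohomology ::
  "(complex^'n) set \<Rightarrow> ('r::finite \<Rightarrow> complex \<Rightarrow> complex^'n) \<Rightarrow> nat \<Rightarrow> int \<Rightarrow>
     ((real^'r) chain \<Rightarrow> int) set monoid" where
  "reduced_lattice_cohomology C \<nu> q n =
     reduced_cohomology_group q (top_of_set (sublevel C \<nu> n))"

end

theory Submission
  imports Defs
begin

text \<open>
  Write \<open>F(l)\<close> for the functions of order at least \<open>l\<^sub>i\<close> along the \<open>i\<close>-th branch. One unit step
  \<open>l \<mapsto> l + e\<^sub>i\<close> lowers \<open>F(l)\<close> by at most one dimension, so the weight changes by \<open>+1\<close> or \<open>-1\<close>. It
  goes up exactly when some \<open>f \<in> F(l)\<close> has order precisely \<open>l\<^sub>i\<close> on the \<open>i\<close>-th branch; we say that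
  there is a jump at \<open>(l, i)\<close>. All that matters about the curve is contained in four properties of
  jumps, collected in the locale \<open>jump_weight\<close>: a jump at \<open>(l, i)\<close> persists when the other
  coordinates of \<open>l\<close> decrease; jumps at \<open>(x, i)\<close> and \<open>(y, i)\<close> give a jump at \<open>(x + y, i)\<close>, by
  multiplying the two functions; a function of positive order on one branch vanishes at the origin
  and so has positive order on every branch; and there is a jump at \<open>(l, i)\<close> as soon as \<open>l\<^sub>i\<close> is large.

  The last property makes each \<open>S\<^sub>n\<close> a finite complex. For \<open>n > 0\<close> it collapses to the origin by
  removing its vertices one at a time, always one with the largest coordinate sum. When \<open>p \<noteq> 0\<close> is
  removed, the cubes that disappear are those with top vertex \<open>p\<close>; they are indexed by the sets
  \<open>I\<close> such that \<open>p - e\<^sub>K\<close> has weight at most \<open>n\<close> for all \<open>K \<subseteq> I\<close>. If this simplicial complex is a cone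
  with some apex \<open>i\<close>, then projecting away from the point \<open>p + e\<^sub>i\<close> retracts these cubes onto the
  rest (\<open>cube_complex_remove_vertex\<close>).

  Such an apex exists for every \<open>p \<noteq> 0\<close> (\<open>descending_cone\<close>). If some step from \<open>p - e\<^sub>i\<close> to \<open>p\<close> is a
  jump, then by monotonicity so is every step from \<open>p - e\<^sub>K - e\<^sub>i\<close> to \<open>p - e\<^sub>K\<close>, so that
  removing \<open>e\<^sub>i\<close> never raises the weight and \<open>i\<close> is an apex. Otherwise a path from \<open>x\<close> to \<open>p\<close> can be
  compared with the reflected path from \<open>0\<close> to \<open>p - x\<close>: by multiplicativity two corresponding steps
  are never both jumps, whence \<open>w(p) + w(p - x) \<le> w(x)\<close>. For \<open>x = e\<^sub>K\<close> with \<open>K \<noteq> \<emptyset>\<close> the right hand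
  side is \<open>2 - |K|\<close> because the ring is local, while \<open>w(p - e\<^sub>K) \<le> w(p) + |K|\<close> trivially; adding the two gives
  \<open>w(p - e\<^sub>K) \<le> 1 \<le> n\<close>, so the complex is a full simplex. This is where \<open>n > 0\<close> enters.

  The vanishing of the reduced cohomology follows because a contraction to a point yields an
  explicit cone operator on singular chains, whose dual contracts the augmented cochain complex.
\<close>

text \<open>The symbol is reserved for components of vectors.\<close>

no_notation fps_nth (infixl \<open>$\<close> 75)

section \<open>Weights with unit steps\<close>

text \<open>
  Mirror image of \<^const>\<open>vertex\<close>: the vertices of a cube as seen from its top vertex. It is meant for
  \<open>p\<close> positive on \<open>K\<close>, where the subtraction is not truncated.
\<close>
definition descend :: "nat^'r \<Rightarrow> 'r set \<Rightarrow> nat^'r" where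
  "descend p K = (\<chi> i. p $ i - (if i \<in> K then 1 else 0))"

lemma vertex_nth: "vertex l K $ i = l $ i + (if i \<in> K then 1 else 0)"
  by (simp add: vertex_def)

lemma descend_nth: "descend p K $ i = p $ i - (if i \<in> K then 1 else 0)"
  by (simp add: descend_def)

lemma vertex_empty [simp]: "vertex l {} = l"
  by (simp add: vec_eq_iff vertex_nth)

lemma descend_empty [simp]: "descend p {} = p"
  by (simp add: vec_eq_iff descend_nth)

lemma vertex_insert: "i \<notin> K \<Longrightarrow> vertex l (insert i K) = vertex (vertex l K) {i}"
  by (simp add: vec_eq_iff vertex_nth)

lemma vertex_descend_insert:
  "i \<notin> K \<Longrightarrow> 0 < p $ i \<Longrightarrow> vertex (descend p (insert i K)) {i} = descend p K"
  by (auto simp: vec_eq_iff vertex_nth descend_nth)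

lemma lattice_point_induct [case_names zero step]:
  fixes l :: "nat^'r::finite"
  assumes zero: "P 0" and step: "\<And>l i. P l \<Longrightarrow> P (vertex l {i})"
  shows "P l"
proof (induction "\<Sum>i\<in>UNIV. l $ i" arbitrary: l)
  case 0
  then have "l = 0" by (simp add: vec_eq_iff)
  with zero show ?case by simp
next
  case (Suc k)
  then obtain i where i: "0 < l $ i"
    by (metis gr0I nat.distinct(1) sum.neutral)
  have "l = vertex (descend l {i}) {i}"
    using i by (simp add: vertex_descend_insert)
  moreover have "(\<Sum>j\<in>UNIV. l $ j) = Suc (\<Sum>j\<in>UNIV. descend l {i} $ j)"
    using i by (simp add: sum.remove[of UNIV i] descend_nth)
  ultimately show ?case
    using Suc step by (metis diff_Suc_1)
qed

text \<open>
  The combinatorial shadow of a curve singularity. The assumption \<open>no_jump_local\<close> expresses that the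
  ring is local, and \<open>conductor\<close> that it has finite codimension in its normalization.
\<close>
locale jump_weight =
  fixes w :: "nat^'r::finite \<Rightarrow> int" and jump :: "nat^'r \<Rightarrow> 'r \<Rightarrow> bool"
  assumes w_0: "w 0 = 0"
    and w_step: "w (vertex l {i}) = w l + (if jump l i then 1 else - 1)"
    and jump_antimono: "jump x i \<Longrightarrow> (\<And>j. y $ j \<le> x $ j) \<Longrightarrow> y $ i = x $ i \<Longrightarrow> jump y i"
    and jump_add: "jump x i \<Longrightarrow> jump y i \<Longrightarrow> jump (x + y) i"
    and no_jump_local: "x $ i = 0 \<Longrightarrow> 0 < x $ j \<Longrightarrow> \<not> jump x i"
    and conductor: "\<exists>c :: nat^'r. \<forall>x i. c $ i \<le> x $ i \<longrightarrow> jump x i"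
begin

lemma w_descend_insert:
  assumes "i \<notin> K" "0 < p $ i"
  shows "w (descend p K) =
         w (descend p (insert i K)) + (if jump (descend p (insert i K)) i then 1 else - 1)"
  by (metis assms vertex_descend_insert w_step)

lemma w_descend_le:
  assumes "\<forall>i\<in>K. 0 < p $ i"
  shows "w (descend p K) \<le> w p + int (card K)"
  using finite[of K] assms
proof (induction K rule: finite_induct)
  case (insert i K)
  then show ?case using w_descend_insert[of i K p] by (auto split: if_splits)
qed simp

text \<open>After a first step away from the origin, locality forbids any further jump inside the unit cube.\<close>
lemma w_unit_cube_le:
  assumes "K \<noteq> {}"
  shows "w (vertex 0 K) \<le> 2 - int (card K)"
  using finite[of K] assms
proof (induction K rule: finite_ne_induct)
  case (singleton i)
  show ?case by (simp add: w_step w_0)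
next
  case (insert i K)
  from insert obtain j where "j \<in> K" by blast
  then have "\<not> jump (vertex 0 K) i"
    using no_jump_local[of "vertex 0 K" i j] insert by (simp add: vertex_nth)
  then show ?case
    using insert by (simp add: vertex_insert[OF \<open>i \<notin> K\<close>] w_step)
qed

text \<open>
  Let \<open>y\<close> run along a path from \<open>0\<close>; then \<open>p - y\<close> runs backwards from \<open>p\<close>. A step of \<open>y\<close> and the
  corresponding step of \<open>p - y\<close> start at points with sum \<open>p - e\<^sub>i\<close>, so they cannot both be jumps,
  and \<open>w(y) - w(p - y)\<close> does not increase along the path.
\<close>
lemma w_reflection_le:
  assumes no: "\<And>i. 0 < p $ i \<Longrightarrow> \<not> jump (descend p {i}) i"
    and "\<And>j. y $ j \<le> p $ j"
  shows "w p + w y \<le> w (p - y)"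
  using assms(2)
proof (induction y rule: lattice_point_induct)
  case zero
  have "p - 0 = p" by (simp add: vec_eq_iff)
  then show ?case by (simp add: w_0)
next
  case (step y i)
  define z where "z = p - vertex y {i}"
  have le: "y $ j \<le> p $ j" for j
    using step.prems[of j] by (simp add: vertex_nth split: if_splits)
  have lt: "y $ i < p $ i"
    using step.prems[of i] by (simp add: vertex_nth)
  have "vertex z {i} = p - y"
    using lt by (auto simp: vec_eq_iff z_def vertex_nth)
  then have wz: "w (p - y) = w z + (if jump z i then 1 else - 1)"
    by (metis w_step)
  have "y + z = descend p {i}"
    using le lt by (auto simp: vec_eq_iff z_def vertex_nth descend_nth)
  then have "\<not> (jump y i \<and> jump z i)"
    using no[of i] lt jump_add by fastforce
  then show ?case
    using step.IH[OF le] wz by (auto simp: w_step z_def split: if_splits)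
qed

text \<open>
  The apex \<open>i\<close> of the complex of cubes hanging below \<open>p\<close>. If no step into \<open>p\<close> is a jump, the bound
  obtained from the reflection inequality holds for all vertices of the unit cube below \<open>p\<close>, so
  any \<open>i\<close> with \<open>p\<^sub>i > 0\<close> will do.
\<close>
lemma descending_cone:
  assumes "0 < n" "p \<noteq> 0" "w p \<le> n"
  shows "\<exists>i. 0 < p $ i \<and> (\<forall>K. i \<notin> K \<longrightarrow> (\<forall>j\<in>K. 0 < p $ j) \<longrightarrow> w (descend p K) \<le> n \<longrightarrow>
                                  w (descend p (insert i K)) \<le> n)"
proof (cases "\<exists>i. 0 < p $ i \<and> jump (descend p {i}) i")
  case True
  then obtain i where i: "0 < p $ i" "jump (descend p {i}) i" by blast
  show ?thesis
  proof (intro exI[of _ i] conjI allI impI i(1))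
    fix K assume K: "i \<notin> K" and "w (descend p K) \<le> n"
    moreover have "jump (descend p (insert i K)) i"
      by (rule jump_antimono[OF i(2)]) (auto simp: descend_nth)
    ultimately show "w (descend p (insert i K)) \<le> n"
      using w_descend_insert[OF K i(1)] by simp
  qed
next
  case False
  then have no: "\<not> jump (descend p {i}) i" if "0 < p $ i" for i
    using that by blast
  \<comment> \<open>For \<open>K \<noteq> \<emptyset>\<close>, the reflection inequality at \<open>y = p - e\<^sub>K\<close> is added to the trivial bound
      \<open>w(p - e\<^sub>K) \<le> w(p) + |K|\<close>. For \<open>K = \<emptyset>\<close> it reads \<open>2 w(p) \<le> 0\<close>.\<close>
  have le1: "w (descend p K) \<le> 1" if K: "\<forall>i\<in>K. 0 < p $ i" for K
  proof (cases "K = {}")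
    case True
    have "w p + w p \<le> w (p - p)"
      using no by (intro w_reflection_le) auto
    then show ?thesis by (simp add: True w_0)
  next
    case ne: False
    have "w p + w (descend p K) \<le> w (p - descend p K)"
      using no by (intro w_reflection_le) (auto simp: descend_nth)
    also have "p - descend p K = vertex 0 K"
      using K by (auto simp: vec_eq_iff vertex_nth descend_nth Suc_leI)
    also have "w (vertex 0 K) \<le> 2 - int (card K)"
      by (rule w_unit_cube_le[OF ne])
    finally show ?thesis
      using w_descend_le[OF K] by linarith
  qed
  from \<open>p \<noteq> 0\<close> obtain i where i: "0 < p $ i"
    by (auto simp: vec_eq_iff)
  show ?thesis
  proof (intro exI[of _ i] conjI allI impI i)
    fix K assume "\<forall>j\<in>K. 0 < p $ j"
    then have "w (descend p (insert i K)) \<le> 1"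
      using i by (intro le1) auto
    then show "w (descend p (insert i K)) \<le> n"
      using \<open>0 < n\<close> by linarith
  qed
qed

text \<open>
  Beyond the conductor \<open>c\<close> every step is a jump, so \<open>w(p)\<close> grows at least like the distance
  of \<open>p\<close> from \<open>c\<close>.
\<close>
lemma finite_sublevel: "finite {p. w p \<le> n}"
proof -
  obtain c :: "nat^'r" where c: "\<And>x i. c $ i \<le> x $ i \<Longrightarrow> jump x i"
    using conductor by blast
  define a where "a = (\<Sum>i\<in>UNIV. int (c $ i))"
  have bound: "(\<Sum>i\<in>UNIV. \<bar>int (p $ i) - int (c $ i)\<bar>) - a \<le> w p" for p
  proof (induction p rule: lattice_point_induct)
    case zero
    show ?case by (simp add: w_0 a_def)
  next
    case (step p i)
    define D where "D q j = \<bar>int (q $ j) - int (c $ j)\<bar>" for q :: "nat^'r" and j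
    have "(\<Sum>j\<in>UNIV. D (vertex p {i}) j) =
          D (vertex p {i}) i + (\<Sum>j\<in>UNIV - {i}. D (vertex p {i}) j)"
      by (rule sum.remove) auto
    also have "(\<Sum>j\<in>UNIV - {i}. D (vertex p {i}) j) = (\<Sum>j\<in>UNIV - {i}. D p j)"
      by (rule sum.cong) (auto simp: D_def vertex_nth)
    also have "\<dots> = (\<Sum>j\<in>UNIV. D p j) - D p i"
      by (simp add: sum_diff1)
    finally have sum: "(\<Sum>j\<in>UNIV. D (vertex p {i}) j) =
                       (\<Sum>j\<in>UNIV. D p j) + (D (vertex p {i}) i - D p i)"
      by simp
    have "D (vertex p {i}) i - D p i \<le> (if jump p i then 1 else - 1)"
    proof (cases "c $ i \<le> p $ i")
      case True
      then show ?thesis using c[OF True] by (simp add: D_def vertex_nth)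
    next
      case False
      then have "D (vertex p {i}) i - D p i = - 1" by (simp add: D_def vertex_nth)
      then show ?thesis by simp
    qed
    moreover have "(\<Sum>j\<in>UNIV. D p j) - a \<le> w p"
      using step by (simp add: D_def)
    ultimately have "(\<Sum>j\<in>UNIV. D (vertex p {i}) j) - a \<le> w (vertex p {i})"
      unfolding sum w_step by linarith
    then show ?case by (simp add: D_def)
  qed
  have le: "int (p $ j) \<le> n + 2 * a" if "w p \<le> n" for p j
  proof -
    have "int (p $ j) - int (c $ j) \<le> (\<Sum>i\<in>UNIV. \<bar>int (p $ i) - int (c $ i)\<bar>)"
      by (rule order_trans[OF abs_ge_self], rule member_le_sum) auto
    moreover have "int (c $ j) \<le> a"
      unfolding a_def by (rule member_le_sum) auto
    ultimately show ?thesis using bound[of p] that by linarith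
  qed
  have "{p. w p \<le> n} \<subseteq> vec_lambda ` (UNIV \<rightarrow>\<^sub>E {..nat (n + 2 * a)})"
  proof
    fix p assume "p \<in> {p. w p \<le> n}"
    then have "p $ j \<le> nat (n + 2 * a)" for j
      using le[of p j] by simp
    then have "(\<lambda>j. p $ j) \<in> UNIV \<rightarrow>\<^sub>E {..nat (n + 2 * a)}"
      by (simp add: PiE_def)
    then show "p \<in> vec_lambda ` (UNIV \<rightarrow>\<^sub>E {..nat (n + 2 * a)})"
      by (rule rev_image_eqI) simp
  qed
  then show ?thesis
    by (rule finite_subset) (rule finite_imageI, rule finite_PiE, rule finite, rule finite_atMost)
qed

end

section \<open>Collapsing cubical complexes\<close>

lemma mem_cube_iff:
  "x \<in> cube l I \<longleftrightarrow>
     (\<forall>j. real (l $ j) \<le> x $ j \<and> x $ j \<le> real (l $ j) + (if j \<in> I then 1 else 0))"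
  by (auto simp: cube_def mem_box_cart vertex_nth)

lemma vertex_descend:
  assumes "K \<subseteq> I" "\<And>j. j \<in> I \<Longrightarrow> 0 < p $ j"
  shows "vertex (descend p I) K = descend p (I - K)"
proof -
  have "vertex (descend p I) K $ j = descend p (I - K) $ j" for j
    using assms(1) assms(2)[of j] by (auto simp: vertex_nth descend_nth)
  then show ?thesis by (simp add: vec_eq_iff)
qed

definition cube_complex :: "(nat^'r) set \<Rightarrow> (real^'r::finite) set" where
  "cube_complex V = \<Union> {cube l I | l I. \<forall>K\<subseteq>I. vertex l K \<in> V}"

lemma closed_cube_complex:
  assumes "finite V"
  shows "closed (cube_complex V)"
proof -
  have "{cube l I | l I. \<forall>K\<subseteq>I. vertex l K \<in> V} \<subseteq> (\<lambda>(l, I). cube l I) ` (V \<times> UNIV)"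
    by (force dest: spec[of _ "{}"])
  then have "finite {cube l I | l I. \<forall>K\<subseteq>I. vertex l K \<in> V}"
    by (rule finite_subset) (simp add: assms)
  then show ?thesis
    unfolding cube_complex_def by (rule closed_Union) (auto simp: cube_def)
qed

text \<open>
  In the coordinates \<open>y = p - x\<close> the star of the top vertex \<open>p\<close> consists of the points of the unit cube
  whose support belongs to a simplicial complex which is a cone with apex \<open>i\<close>, and the part of the
  star that survives the removal of \<open>p\<close> is the set where \<open>max y\<^sub>j = 1\<close>. Radial projection from the
  point \<open>y = -e\<^sub>i\<close> maps the star to this part: it enlarges the support at most by \<open>i\<close>, which the cone
  condition permits, and it fixes the points where the maximum is already \<open>1\<close>.
\<close>
lemma cube_complex_remove_vertex:
  fixes V :: "(nat^'r::finite) set"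
  assumes fin: "finite V"
    and top: "\<And>q. q \<in> V \<Longrightarrow> q \<noteq> p \<Longrightarrow> \<exists>j. q $ j < p $ j"
    and i: "0 < p $ i"
    and cone: "\<And>K. i \<notin> K \<Longrightarrow> (\<And>j. j \<in> K \<Longrightarrow> 0 < p $ j) \<Longrightarrow> descend p K \<in> V \<Longrightarrow>
                     descend p (insert i K) \<in> V"
  shows "cube_complex V homotopy_eqv cube_complex (V - {p})"
proof -
  define star where
    "star = \<Union> {cube (descend p I) I | I.
                  (\<forall>j\<in>I. 0 < p $ j) \<and> (\<forall>K\<subseteq>I. descend p K \<in> V)}"
  let ?X = "cube_complex V" and ?Y = "cube_complex (V - {p})"
  have closed_star: "closed star"
    unfolding star_def by (rule closed_Union) (auto simp: cube_def)
  have star_sub: "cube (descend p I) I \<subseteq> ?X"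
    if I: "\<forall>j\<in>I. 0 < p $ j" "\<forall>K\<subseteq>I. descend p K \<in> V" for I
  proof -
    have "\<forall>K\<subseteq>I. vertex (descend p I) K \<in> V"
      using I by (auto simp: vertex_descend)
    then show ?thesis unfolding cube_complex_def by blast
  qed
  have X_eq: "?X = ?Y \<union> star"
  proof
    show "?X \<subseteq> ?Y \<union> star"
    proof
      fix x assume "x \<in> ?X"
      then obtain l I where x: "x \<in> cube l I" and V: "\<forall>K\<subseteq>I. vertex l K \<in> V"
        unfolding cube_complex_def by blast
      show "x \<in> ?Y \<union> star"
      proof (cases "\<exists>K\<subseteq>I. vertex l K = p")
        case False
        then show ?thesis using x V unfolding cube_complex_def by blast
      next
        case True
        then obtain K where K: "K \<subseteq> I" "vertex l K = p" by blast
        have "\<not> (\<exists>j. vertex l I $ j < p $ j)"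
          using K by (auto simp: vertex_nth split: if_splits)
        then have p: "vertex l I = p" using top V by blast
        then have pj: "p $ j = l $ j + (if j \<in> I then 1 else 0)" for j
          by (metis vertex_nth)
        have l: "l = descend p I"
          by (simp add: vec_eq_iff descend_nth pj)
        have pos: "\<forall>j\<in>I. 0 < p $ j" by (simp add: pj)
        have "descend p K \<in> V" if "K \<subseteq> I" for K
        proof -
          have "descend p K = vertex l (I - K)"
            using that pos by (simp add: l vertex_descend double_diff)
          then show ?thesis using V by simp
        qed
        then show ?thesis using x pos unfolding star_def l by blast
      qed
    qed
    have "?Y \<subseteq> ?X" unfolding cube_complex_def by blast
    moreover have "star \<subseteq> ?X" using star_sub unfolding star_def by blast
    ultimately show "?Y \<union> star \<subseteq> ?X" by blast
  qed

  \<comment> \<open>The projection scales \<open>y + e\<^sub>i\<close> by \<open>1 / m\<close>, where \<open>m\<close> is the largest of the numbers \<open>y\<^sub>j\<close>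
      for \<open>j \<noteq> i\<close> and \<open>(1 + y\<^sub>i) / 2\<close>. These are collected in the vector \<open>z\<close>. They are nonnegative,
      so their maximum is the continuous function \<open>infnorm z\<close>, and \<open>m \<ge> 1/2\<close>.\<close>
  define z where "z x = (\<chi> j. if j = i then (1 + (real (p $ i) - x $ i)) / 2 else real (p $ j) - x $ j)"
    for x :: "real^'r"
  define m where "m x = infnorm (z x)" for x
  define \<rho> where "\<rho> x = (\<chi> j. real (p $ j) - (if j = i then 2 * z x $ i / m x - 1 else z x $ j / m x))"
    for x
  have z_nth: "z x $ j = (if j = i then (1 + (real (p $ i) - x $ i)) / 2 else real (p $ j) - x $ j)" for x j
    by (simp add: z_def)
  have \<rho>_nth: "\<rho> x $ j = real (p $ j) - (if j = i then 2 * z x $ i / m x - 1 else z x $ j / m x)" for x j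
    by (simp add: \<rho>_def)

  have m_props: "1 / 2 \<le> m x \<and> m x \<le> 1 \<and> (\<forall>j. 0 \<le> z x $ j \<and> z x $ j \<le> m x) \<and> (\<exists>j. z x $ j = m x)"
    if y: "\<And>j. 0 \<le> real (p $ j) - x $ j \<and> real (p $ j) - x $ j \<le> 1" for x
  proof -
    have z01: "0 \<le> z x $ j \<and> z x $ j \<le> 1" for j
      using y[of j] by (auto simp: z_nth)
    have le: "z x $ j \<le> m x" for j
      using component_le_infnorm_cart[of "z x" j] z01[of j] by (simp add: m_def)
    have "{\<bar>z x $ j\<bar> | j. j \<in> UNIV} = range (\<lambda>j. \<bar>z x $ j\<bar>)" by auto
    then have "m x = Max (range (\<lambda>j. \<bar>z x $ j\<bar>))"
      by (simp add: m_def infnorm_cart cSup_eq_Max)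
    moreover have "Max (range (\<lambda>j. \<bar>z x $ j\<bar>)) \<in> range (\<lambda>j. \<bar>z x $ j\<bar>)"
      by (rule Max_in) auto
    ultimately have "m x \<in> range (\<lambda>j. \<bar>z x $ j\<bar>)" by simp
    then obtain j where "m x = \<bar>z x $ j\<bar>" by (rule imageE)
    then have j: "m x = z x $ j" using z01[of j] by simp
    have "1 / 2 \<le> z x $ i" using y[of i] by (simp add: z_nth)
    then show ?thesis using le[of i] le z01 j by (metis order_trans)
  qed

  have in_star: "0 \<le> real (p $ j) - x $ j \<and> real (p $ j) - x $ j \<le> 1 \<and> (j \<notin> I \<longrightarrow> x $ j = real (p $ j))"
    if "x \<in> cube (descend p I) I" "\<forall>j\<in>I. 0 < p $ j" for x I j
  proof (cases "j \<in> I")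
    case True
    with that(2) have "real (descend p I $ j) = real (p $ j) - 1"
      by (auto simp: descend_nth of_nat_diff Suc_leI)
    with that(1) True show ?thesis unfolding mem_cube_iff by (smt (verit, best))
  next
    case False
    then have "real (descend p I $ j) = real (p $ j)" by (simp add: descend_nth)
    with that(1) False show ?thesis unfolding mem_cube_iff by (smt (verit, best))
  qed

  \<comment> \<open>The cube below contains both \<open>x\<close> and its projection, hence also the segment between them.\<close>
  have \<rho>_star: "\<exists>I. (\<forall>j\<in>I. 0 < p $ j) \<and> (\<forall>K\<subseteq>I. descend p K \<in> V) \<and>
                     x \<in> cube (descend p I) I \<and> \<rho> x \<in> cube (descend p I) I \<and> \<rho> x \<in> ?Y"
    if "x \<in> star" for x
  proof -
    from that obtain I0 where x: "x \<in> cube (descend p I0) I0"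
      and pos0: "\<forall>j\<in>I0. 0 < p $ j" and V0: "\<forall>K\<subseteq>I0. descend p K \<in> V"
      unfolding star_def by blast
    define I where "I = insert i I0"
    have pos: "\<forall>j\<in>I. 0 < p $ j" using pos0 i by (simp add: I_def)
    have V: "descend p K \<in> V" if "K \<subseteq> I" for K
    proof (cases "i \<in> K")
      case True
      have "K - {i} \<subseteq> I0" using that by (auto simp: I_def)
      then have "descend p (insert i (K - {i})) \<in> V"
        using pos0 V0 by (intro cone) auto
      then show ?thesis using True by (simp add: insert_absorb)
    next
      case False
      then have "K \<subseteq> I0" using that by (auto simp: I_def)
      then show ?thesis using V0 by blast
    qed
    have dI: "real (descend p I $ j) = real (p $ j) - (if j \<in> I then 1 else 0)" for j
      using pos by (auto simp: descend_nth of_nat_diff Suc_leI)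
    note y = in_star[OF x pos0]
    have m: "1 / 2 \<le> m x" "m x \<le> 1" "\<And>j. 0 \<le> z x $ j" "\<And>j. z x $ j \<le> m x" "\<exists>j. z x $ j = m x"
      using m_props[of x] y by blast+
    define y' where "y' j = real (p $ j) - \<rho> x $ j" for j
    have y'_eq: "y' j = (if j = i then 2 * z x $ i / m x - 1 else z x $ j / m x)" for j
      by (simp add: y'_def \<rho>_nth)
    have "m x \<le> 2 * z x $ i"
      using m(2) y[of i] by (simp add: z_nth)
    then have y'01: "0 \<le> y' j \<and> y' j \<le> 1" for j
      using m(1) m(3,4)[of j] m(4)[of i] by (auto simp: y'_eq field_simps)
    have y'0: "y' j = 0" if "j \<notin> I" for j
      using that y[of j] by (auto simp: y'_eq z_nth I_def)
    obtain j where j: "y' j = 1"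
    proof -
      from m(5) obtain j where "z x $ j = m x" by blast
      then have "y' j = 1" using m(1) by (auto simp: y'_eq)
      then show ?thesis by (rule that)
    qed
    then have "j \<in> I" using y'0[of j] by auto
    have "x \<in> cube (descend p I) I"
      unfolding mem_cube_iff
    proof
      fix k
      show "real (descend p I $ k) \<le> x $ k \<and>
            x $ k \<le> real (descend p I $ k) + (if k \<in> I then 1 else 0)"
        using y[of k] unfolding dI by (auto simp: I_def)
    qed
    moreover have sub: "\<rho> x \<in> cube (descend p I) (I - {j})"
      unfolding mem_cube_iff
    proof
      fix k
      have "\<rho> x $ k = real (p $ k) - y' k" by (simp add: y'_def)
      then show "real (descend p I $ k) \<le> \<rho> x $ k \<and>
            \<rho> x $ k \<le> real (descend p I $ k) + (if k \<in> I - {j} then 1 else 0)"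
        using y'01[of k] y'0[of k] j unfolding dI by auto
    qed
    moreover have "cube (descend p I) (I - {j}) \<subseteq> cube (descend p I) I"
    proof
      fix u assume u: "u \<in> cube (descend p I) (I - {j})"
      show "u \<in> cube (descend p I) I"
        unfolding mem_cube_iff
      proof
        fix k
        show "real (descend p I $ k) \<le> u $ k \<and>
              u $ k \<le> real (descend p I $ k) + (if k \<in> I then 1 else 0)"
          using u[unfolded mem_cube_iff, rule_format, of k] by (auto split: if_splits)
      qed
    qed
    moreover have "vertex (descend p I) K \<in> V - {p}" if K: "K \<subseteq> I - {j}" for K
    proof -
      have eq: "vertex (descend p I) K = descend p (I - K)"
        using K pos by (intro vertex_descend) auto
      have "descend p (I - K) $ j < p $ j"
        using K \<open>j \<in> I\<close> pos by (auto simp: descend_nth)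
      then show ?thesis using V[of "I - K"] by (auto simp: eq)
    qed
    then have "cube (descend p I) (I - {j}) \<subseteq> ?Y"
      unfolding cube_complex_def by blast
    ultimately show ?thesis using pos V by blast
  qed

  have \<rho>_fix: "\<rho> x = x" if "x \<in> star" "x \<in> ?Y" for x
  proof -
    from that(1) obtain I where x: "x \<in> cube (descend p I) I"
      and pos: "\<forall>j\<in>I. 0 < p $ j"
      unfolding star_def by blast
    note y = in_star[OF x pos]
    from that(2) obtain l J where J: "x \<in> cube l J" "\<forall>K\<subseteq>J. vertex l K \<in> V - {p}"
      unfolding cube_complex_def by blast
    then obtain j where j: "vertex l J $ j < p $ j"
      using top[of "vertex l J"] by auto
    have "x $ j \<le> real (vertex l J $ j)"
      using J(1)[unfolded mem_cube_iff, rule_format, of j] by (simp add: vertex_nth split: if_splits)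
    also have "\<dots> \<le> real (p $ j) - 1" using j by linarith
    finally have "real (p $ j) - x $ j = 1" using y[of j] by linarith
    then have "z x $ j = 1" by (auto simp: z_nth)
    then have "m x = 1" using m_props[of x] y by (metis order_antisym)
    then show ?thesis by (simp add: vec_eq_iff \<rho>_nth z_nth field_simps)
  qed

  define r where "r x = (if x \<in> ?Y then x else \<rho> x)" for x
  have cont_\<rho>: "continuous_on star \<rho>"
  proof -
    have cz: "continuous_on star (\<lambda>x. z x $ j)" for j
      unfolding z_nth by (cases "j = i") (auto intro!: continuous_intros)
    have "continuous_on star (\<lambda>x. \<chi> j. z x $ j)"
      by (rule continuous_on_vec_lambda) (rule cz)
    then have contz: "continuous_on star z" by simp
    from contz have cm: "continuous_on star m"
      unfolding m_def by (rule continuous_on_infnorm)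
    have "m x \<noteq> 0" if "x \<in> star" for x
    proof -
      from that obtain I where "x \<in> cube (descend p I) I" "\<forall>j\<in>I. 0 < p $ j"
        unfolding star_def by blast
      from m_props[OF conjI, OF in_star[OF this, THEN conjunct1] in_star[OF this, THEN conjunct2, THEN conjunct1]]
      show ?thesis by auto
    qed
    then have "continuous_on star (\<lambda>x. \<rho> x $ j)" for j
      unfolding \<rho>_nth using contz cm by (cases "j = i") (auto intro!: continuous_intros)
    then have "continuous_on star (\<lambda>x. \<chi> j. \<rho> x $ j)"
      by (rule continuous_on_vec_lambda)
    then show ?thesis by simp
  qed
  have cont_r: "continuous_on ?X r"
    unfolding X_eq r_def
  proof (rule continuous_on_cases)
    show "closed ?Y" using fin by (simp add: closed_cube_complex)
    show "\<forall>x. x \<in> ?Y \<and> x \<notin> ?Y \<or> x \<in> star \<and> x \<in> ?Y \<longrightarrow> x = \<rho> x"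
      using \<rho>_fix by auto
  qed (use closed_star cont_\<rho> in \<open>auto simp: continuous_on_id\<close>)
  have segment: "closed_segment x (r x) \<subseteq> ?X" if "x \<in> ?X" for x
  proof (cases "x \<in> ?Y")
    case True
    then show ?thesis using that by (simp add: r_def)
  next
    case False
    then have "x \<in> star" using that X_eq by blast
    from \<rho>_star[OF this] obtain I where I: "\<forall>j\<in>I. 0 < p $ j" "\<forall>K\<subseteq>I. descend p K \<in> V"
      "x \<in> cube (descend p I) I" "\<rho> x \<in> cube (descend p I) I"
      by blast
    have "convex (cube (descend p I) I)"
      by (simp add: cube_def)
    then have "closed_segment x (\<rho> x) \<subseteq> cube (descend p I) I"
      using I by (simp add: closed_segment_subset)
    also have "\<dots> \<subseteq> ?X" by (rule star_sub[OF I(1,2)])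
    finally show ?thesis using False by (simp add: r_def)
  qed
  have "homotopic_with_canon (\<lambda>x. True) ?X ?X id r"
    using cont_r segment by (intro homotopic_with_linear) auto
  moreover have "retraction ?X ?Y r"
    unfolding retraction_def
  proof (intro conjI)
    show "?Y \<subseteq> ?X" using X_eq by blast
    show "continuous_on ?X r" by (rule cont_r)
    have "\<rho> x \<in> ?Y" if "x \<in> star" for x
      using \<rho>_star[OF that] by (elim exE conjE)
    then show "r \<in> ?X \<rightarrow> ?Y" using X_eq by (auto simp: r_def)
    show "\<forall>x\<in>?Y. r x = x" by (simp add: r_def)
  qed
  ultimately show ?thesis
    by (rule deformation_retract_imp_homotopy_eqv)
qed

text \<open>
  The cone condition at \<open>q\<close> only involves vertices below \<open>q\<close>. It therefore survives the removal of a
  vertex of largest coordinate sum, and the vertices can be removed one by one down to the origin.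
\<close>
theorem contractible_cube_complex:
  fixes V :: "(nat^'r::finite) set"
  assumes "finite V" "0 \<in> V"
    and "\<And>p. p \<in> V \<Longrightarrow> p \<noteq> 0 \<Longrightarrow>
           \<exists>i. 0 < p $ i \<and> (\<forall>K. i \<notin> K \<longrightarrow> (\<forall>j\<in>K. 0 < p $ j) \<longrightarrow> descend p K \<in> V \<longrightarrow>
                                  descend p (insert i K) \<in> V)"
  shows "contractible (cube_complex V)"
  using assms
proof (induction "card V" arbitrary: V rule: less_induct)
  case less
  define size where "size p = (\<Sum>j\<in>UNIV. p $ j)" for p :: "nat^'r"
  show ?case
  proof (cases "V = {0}")
    case True
    have "cube_complex V \<subseteq> {0}"
    proof
      fix x assume "x \<in> cube_complex V"
      then obtain l I where x: "x \<in> cube l I" and V: "\<forall>K\<subseteq>I. vertex l K \<in> V"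
        unfolding cube_complex_def by blast
      from V have "vertex l {} = 0" "vertex l I = 0" using True by blast+
      then have "l $ j = 0" "j \<notin> I" for j
        using vertex_nth[of l I j] by (auto split: if_splits)
      then show "x \<in> {0}" using x by (simp add: mem_cube_iff vec_eq_iff order_antisym)
    qed
    then show ?thesis
      by (metis contractible_empty contractible_sing subset_singletonD)
  next
    case False
    with less.prems(2) have ne: "V - {0} \<noteq> {}" by blast
    have "Max (size ` (V - {0})) \<in> size ` (V - {0})"
      using less.prems(1) ne by (intro Max_in) auto
    then obtain p where "Max (size ` (V - {0})) = size p" "p \<in> V - {0}"
      by (rule imageE)
    then have p: "p \<in> V" "p \<noteq> 0" "size p = Max (size ` (V - {0}))"
      by auto
    have max: "size q \<le> size p" if "q \<in> V" for q
    proof (cases "q = 0")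
      case True
      then show ?thesis by (simp add: size_def)
    next
      case False
      then show ?thesis using that less.prems(1) unfolding p(3) by (intro Max_ge) auto
    qed
    have less_size: "size u < size v" if "\<And>j. u $ j \<le> v $ j" "u $ j < v $ j" for u v j
      unfolding size_def using that by (intro sum_strict_mono_ex1) auto
    obtain i where i: "0 < p $ i"
      and cone: "\<forall>K. i \<notin> K \<longrightarrow> (\<forall>j\<in>K. 0 < p $ j) \<longrightarrow> descend p K \<in> V \<longrightarrow>
                       descend p (insert i K) \<in> V"
      using less.prems(3)[OF p(1,2)] by (elim exE conjE)
    have "\<exists>j. q $ j < p $ j" if "q \<in> V" "q \<noteq> p" for q
    proof (rule ccontr)
      assume "\<nexists>j. q $ j < p $ j"
      then have le: "p $ j \<le> q $ j" for j by (simp add: not_less)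
      obtain j where "p $ j \<noteq> q $ j" using \<open>q \<noteq> p\<close> by (metis vec_eq_iff)
      then have "p $ j < q $ j" using le[of j] by simp
      then have "size p < size q" using le by (rule less_size[rotated])
      then show False using max[OF \<open>q \<in> V\<close>] by simp
    qed
    then have "cube_complex V homotopy_eqv cube_complex (V - {p})"
      using less.prems(1) i cone by (intro cube_complex_remove_vertex) auto
    moreover have "contractible (cube_complex (V - {p}))"
    proof (rule less.hyps)
      show "card (V - {p}) < card V"
        using less.prems(1) p(1) by (rule card_Diff1_less)
      show "finite (V - {p})" "0 \<in> V - {p}"
        using less.prems p by auto
      fix q assume q: "q \<in> V - {p}" "q \<noteq> 0"
      then obtain i where i: "0 < q $ i"
        "\<forall>K. i \<notin> K \<longrightarrow> (\<forall>j\<in>K. 0 < q $ j) \<longrightarrow> descend q K \<in> V \<longrightarrow>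
             descend q (insert i K) \<in> V"
        using less.prems(3)[of q] by (elim DiffE) (drule meta_mp, assumption, blast)
      have "descend q (insert i K) \<noteq> p" for K
        using less_size[of "descend q (insert i K)" q i] i(1) max[of q] q(1)
        by (auto simp: descend_nth)
      then show "\<exists>i. 0 < q $ i \<and> (\<forall>K. i \<notin> K \<longrightarrow> (\<forall>j\<in>K. 0 < q $ j) \<longrightarrow>
                   descend q K \<in> V - {p} \<longrightarrow> descend q (insert i K) \<in> V - {p})"
        using i by blast
    qed
    ultimately show ?thesis
      using homotopy_eqv_contractibility by blast
  qed
qed

section \<open>Reduced cohomology of contractible spaces\<close>

text \<open>
  The cone on a simplex \<open>\<sigma>\<close> with new vertex number \<open>0\<close>, formed by running \<open>\<sigma>\<close> along a contraction \<open>H\<close>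
  of the space to \<open>a\<close>. The contraction is already finished at \<open>t\<^sub>0 = 1/2\<close>: continuity at the
  cone point, where \<open>t / (1 - t\<^sub>0)\<close> degenerates, is then immediate.
\<close>
definition cone_simplex ::
  "(real \<times> 'a \<Rightarrow> 'a) \<Rightarrow> 'a \<Rightarrow> nat \<Rightarrow> ((nat \<Rightarrow> real) \<Rightarrow> 'a) \<Rightarrow> (nat \<Rightarrow> real) \<Rightarrow> 'a" where
  "cone_simplex H a q \<sigma> =
     restrict (\<lambda>t. if t 0 \<le> 1 / 2 then H (2 * t 0, \<sigma> (\<lambda>i. t (Suc i) / (1 - t 0))) else a)
       (standard_simplex (Suc q))"

lemma standard_simplex_project:
  assumes t: "t \<in> standard_simplex (Suc q)" and "t 0 < 1"
  shows "(\<lambda>i. t (Suc i) / (1 - t 0)) \<in> standard_simplex q"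
proof -
  have t01: "0 \<le> t i" for i
    using t by (simp add: standard_simplex_def)
  have t0: "t i = 0" if "i > Suc q" for i
    using t that by (simp add: standard_simplex_def)
  have sum: "(\<Sum>i\<le>Suc q. t i) = 1"
    using t by (simp add: standard_simplex_def)
  have sum': "(\<Sum>i\<le>q. t (Suc i)) = 1 - t 0"
    using sum by (simp add: sum.atMost_Suc_shift del: sum.atMost_Suc)
  have "t (Suc i) \<le> 1 - t 0" for i
  proof (cases "i \<le> q")
    case True
    then have "t (Suc i) \<le> (\<Sum>i\<le>q. t (Suc i))"
      by (intro member_le_sum) (auto simp: t01)
    then show ?thesis by (simp add: sum')
  next
    case False
    then show ?thesis using \<open>t 0 < 1\<close> by (simp add: t0)
  qed
  moreover have "(\<Sum>i\<le>q. t (Suc i) / (1 - t 0)) = 1"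
    using \<open>t 0 < 1\<close> by (simp add: sum' flip: sum_divide_distrib)
  ultimately show ?thesis
    using \<open>t 0 < 1\<close> t01 t0 by (simp add: standard_simplex_def)
qed

lemma singular_simplex_cone_simplex:
  assumes H: "continuous_map (prod_topology (top_of_set {0..1}) X) X H"
    and H1: "\<And>x. x \<in> topspace X \<Longrightarrow> H (1, x) = a"
    and a: "a \<in> topspace X"
    and \<sigma>: "singular_simplex q X \<sigma>"
  shows "singular_simplex (Suc q) X (cone_simplex H a q \<sigma>)"
proof -
  let ?D = "subtopology (powertop_real UNIV) (standard_simplex (Suc q))"
  let ?A = "subtopology ?D {t \<in> topspace ?D. t 0 \<le> 1 / 2}"
  let ?pr = "\<lambda>t i. t (Suc i) / (1 - t (0::nat)) :: real"
  have cont\<sigma>: "continuous_map (subtopology (powertop_real UNIV) (standard_simplex q)) X \<sigma>"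
    using \<sigma> by (simp add: singular_simplex_def)
  have topA: "topspace ?A = {t \<in> standard_simplex (Suc q). t 0 \<le> 1 / 2}"
    by auto
  have proj: "continuous_map ?A euclideanreal (\<lambda>t. t i)" for i
    by (intro continuous_map_from_subtopology continuous_map_product_projection) auto
  have proj_D: "continuous_map ?D euclideanreal (\<lambda>t. t i)" for i
    by (intro continuous_map_from_subtopology continuous_map_product_projection) auto
  have "continuous_map ?A (powertop_real UNIV) ?pr"
    unfolding continuous_map_componentwise_UNIV
  proof
    fix i
    show "continuous_map ?A euclideanreal (\<lambda>t. t (Suc i) / (1 - t 0))"
      by (intro continuous_map_real_divide continuous_map_diff proj) (auto simp: topA)
  qed
  moreover have "?pr t \<in> standard_simplex q" if "t \<in> topspace ?A" for t
    using that standard_simplex_project[of t q] unfolding topA by auto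
  ultimately have "continuous_map ?A (subtopology (powertop_real UNIV) (standard_simplex q)) ?pr"
    by (simp add: continuous_map_in_subtopology Pi_iff)
  from continuous_map_compose[OF this cont\<sigma>]
  have cont\<sigma>pr: "continuous_map ?A X (\<lambda>t. \<sigma> (?pr t))"
    by (simp add: o_def)
  have "continuous_map ?A (top_of_set {0..1}) (\<lambda>t. 2 * t 0)"
    unfolding continuous_map_in_subtopology
  proof
    show "continuous_map ?A euclideanreal (\<lambda>t. 2 * t 0)"
      by (intro continuous_map_real_mult_left proj)
    show "(\<lambda>t. 2 * t 0) \<in> topspace ?A \<rightarrow> {0..1}"
      unfolding topA by (auto simp: standard_simplex_def)
  qed
  then have "continuous_map ?A (prod_topology (top_of_set {0..1}) X) (\<lambda>t. (2 * t 0, \<sigma> (?pr t)))"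
    using cont\<sigma>pr by (simp add: continuous_map_pairwise o_def)
  from continuous_map_compose[OF this H]
  have contH: "continuous_map ?A X (\<lambda>t. H (2 * t 0, \<sigma> (?pr t)))"
    by (simp add: o_def)
  have "continuous_map ?D X (\<lambda>t. if t 0 \<le> 1 / 2 then H (2 * t 0, \<sigma> (?pr t)) else a)"
  proof (rule continuous_map_cases_le)
    show "continuous_map ?D euclideanreal (\<lambda>t. t 0)" by (rule proj_D)
    show "continuous_map ?D euclideanreal (\<lambda>t. 1 / 2)" by simp
    show "continuous_map ?A X (\<lambda>t. H (2 * t 0, \<sigma> (?pr t)))" by (rule contH)
    show "continuous_map (subtopology ?D {t \<in> topspace ?D. 1 / 2 \<le> t 0}) X (\<lambda>t. a)"
      using a by simp
    show "H (2 * t 0, \<sigma> (?pr t)) = a" if "t \<in> topspace ?D" "t 0 = 1 / 2" for t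
    proof -
      have "\<sigma> (?pr t) \<in> topspace X"
        using continuous_map_image_subset_topspace[OF cont\<sigma>pr] that by (auto simp: topA)
      moreover have "2 * t 0 = 1" using that(2) by simp
      ultimately show ?thesis by (simp only: H1)
    qed
  qed
  then show ?thesis
    by (simp add: singular_simplex_def cone_simplex_def)
qed

lemma singular_face_0_cone_simplex:
  assumes H0: "\<And>x. x \<in> topspace X \<Longrightarrow> H (0, x) = x" and \<sigma>: "singular_simplex q X \<sigma>"
  shows "singular_face (Suc q) 0 (cone_simplex H a q \<sigma>) = \<sigma>"
proof
  fix x
  show "singular_face (Suc q) 0 (cone_simplex H a q \<sigma>) x = \<sigma> x"
  proof (cases "x \<in> standard_simplex q")
    case True
    then have "simplical_face 0 x \<in> standard_simplex (Suc q)"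
      using simplical_face_in_standard_simplex[of "Suc q" 0 x] by simp
    moreover have "\<sigma> x \<in> topspace X"
      using \<sigma> True by (auto simp: singular_simplex_def continuous_map_def)
    ultimately show ?thesis
      using True H0 by (simp add: singular_face_def cone_simplex_def) (simp add: simplical_face_def)
  next
    case False
    then show ?thesis
      using \<sigma> by (auto simp: singular_face_def singular_simplex_def extensional_def)
  qed
qed

lemma singular_face_Suc_cone_simplex:
  assumes "0 < q" "k \<le> q"
  shows "singular_face (Suc q) (Suc k) (cone_simplex H a q \<sigma>) =
         cone_simplex H a (q - 1) (singular_face q k \<sigma>)"
proof
  fix x
  show "singular_face (Suc q) (Suc k) (cone_simplex H a q \<sigma>) x =
        cone_simplex H a (q - 1) (singular_face q k \<sigma>) x"
  proof (cases "x \<in> standard_simplex q")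
    case True
    then have face: "simplical_face (Suc k) x \<in> standard_simplex (Suc q)"
      using simplical_face_in_standard_simplex[of "Suc q" "Suc k" x] assms by simp
    have face0: "simplical_face (Suc k) x 0 = x 0"
      by (simp add: simplical_face_def)
    have eq: "(\<lambda>i. simplical_face (Suc k) x (Suc i) / (1 - x 0)) =
          simplical_face k (\<lambda>i. x (Suc i) / (1 - x 0))"
    proof
      fix i
      show "simplical_face (Suc k) x (Suc i) / (1 - x 0) =
            simplical_face k (\<lambda>i. x (Suc i) / (1 - x 0)) i"
        by (cases i) (auto simp: simplical_face_def)
    qed
    have "(\<lambda>i. x (Suc i) / (1 - x 0)) \<in> standard_simplex (q - 1)" if "x 0 \<le> 1 / 2"
      using that True assms(1) by (intro standard_simplex_project) auto
    then show ?thesis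
      using True face face0 eq assms(1) by (auto simp: singular_face_def cone_simplex_def)
  next
    case False
    then show ?thesis
      using assms(1) by (simp add: singular_face_def cone_simplex_def)
  qed
qed

lemma singular_face_1_cone_simplex_0:
  "singular_face (Suc 0) (Suc 0) (cone_simplex H a 0 \<sigma>) = restrict (\<lambda>_. a) (standard_simplex 0)"
proof
  fix x
  show "singular_face (Suc 0) (Suc 0) (cone_simplex H a 0 \<sigma>) x = restrict (\<lambda>_. a) (standard_simplex 0) x"
  proof (cases "x \<in> standard_simplex 0")
    case True
    then have "simplical_face (Suc 0) x \<in> standard_simplex (Suc 0)"
      using simplical_face_in_standard_simplex[of "Suc 0" "Suc 0" x] by simp
    moreover have "simplical_face (Suc 0) x 0 = 1"
      using True by (simp add: simplical_face_def standard_simplex_0)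
    ultimately show ?thesis using True by (simp add: singular_face_def cone_simplex_def)
  next
    case False
    then show ?thesis by (simp add: singular_face_def)
  qed
qed

definition chain_cone :: "(real \<times> 'a \<Rightarrow> 'a) \<Rightarrow> 'a \<Rightarrow> nat \<Rightarrow> 'a chain \<Rightarrow> 'a chain" where
  "chain_cone H a q = frag_extend (\<lambda>\<sigma>. frag_of (cone_simplex H a q \<sigma>))"

text \<open>
  Sending every simplex to the same generator turns the augmentation into the linear extension
  of a constant map, which makes its additivity available.
\<close>
lemma augmentation_eq_lookup:
  "augmentation c = Poly_Mapping.lookup (frag_extend (\<lambda>_. frag_of u) c) u"
  by (simp add: augmentation_def frag_extend_def Poly_Mapping.lookup_sum)

lemma augmentation_diff: "augmentation (a - b) = augmentation a - augmentation b"
  by (simp add: augmentation_eq_lookup[where u = "()"] frag_extend_diff lookup_minus)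

lemma augmentation_add: "augmentation (a + b) = augmentation a + augmentation b"
  by (simp add: augmentation_eq_lookup[where u = "()"] frag_extend_add lookup_add)

lemma augmentation_of [simp]: "augmentation (frag_of \<sigma>) = 1"
  by (simp add: augmentation_def)

lemma augmentation_0 [simp]: "augmentation 0 = 0"
  by (simp add: augmentation_def)

lemma augmentation_boundary: "augmentation (chain_boundary (Suc 0) c) = 0"
  using subset_UNIV
proof (induction c rule: frag_induction)
  case (one \<sigma>)
  have "frag_cmul (- 1) (frag_of (singular_face (Suc 0) (Suc 0) \<sigma>)) =
        0 - frag_of (singular_face (Suc 0) (Suc 0) \<sigma>)"
    by simp
  then show ?case
    by (simp only: chain_boundary_of augmentation_add augmentation_diff augmentation_of
        sum.atMost_Suc) (simp add: augmentation_add augmentation_diff)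
qed (simp_all add: chain_boundary_diff augmentation_diff)

text \<open>
  The cone operator is a contracting homotopy of the augmented singular chain complex: face \<open>0\<close> of a
  cone is its base and the other faces are the cones on the faces of the base. In degree \<open>0\<close> the
  remaining face is the cone point.
\<close>
lemma chain_boundary_chain_cone:
  assumes H0: "\<And>x. x \<in> topspace X \<Longrightarrow> H (0, x) = x"
    and c: "singular_chain (Suc q) X c"
  shows "chain_boundary (Suc (Suc q)) (chain_cone H a (Suc q) c) =
         c - chain_cone H a q (chain_boundary (Suc q) c)"
  using c[unfolded singular_chain_def]
proof (induction c rule: frag_induction)
  case (one \<sigma>)
  let ?f = "\<lambda>k. frag_cmul ((- 1) ^ k) (frag_of (singular_face (Suc (Suc q)) k (cone_simplex H a (Suc q) \<sigma>)))"
  have "chain_boundary (Suc (Suc q)) (chain_cone H a (Suc q) (frag_of \<sigma>)) = (\<Sum>k\<le>Suc (Suc q). ?f k)"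
    by (simp add: chain_cone_def chain_boundary_of del: sum.atMost_Suc)
  also have "\<dots> = ?f 0 + (\<Sum>k\<le>Suc q. ?f (Suc k))"
    by (rule sum.atMost_Suc_shift)
  also have "?f 0 = frag_of \<sigma>"
    using one singular_face_0_cone_simplex[where H = H and X = X and q = "Suc q" and a = a, OF H0]
    by simp
  also have "(\<Sum>k\<le>Suc q. ?f (Suc k)) =
             (\<Sum>k\<le>Suc q. - frag_cmul ((- 1) ^ k) (frag_of (cone_simplex H a q (singular_face (Suc q) k \<sigma>))))"
    by (rule sum.cong) (auto simp: singular_face_Suc_cone_simplex)
  also have "\<dots> = - chain_cone H a q (chain_boundary (Suc q) (frag_of \<sigma>))"
    by (simp add: chain_cone_def chain_boundary_of frag_extend_sum frag_extend_cmul o_def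
        del: sum.atMost_Suc flip: sum_negf)
  finally show ?case by simp
next
  case (diff c d)
  then show ?case
    by (simp add: chain_cone_def frag_extend_diff chain_boundary_diff algebra_simps)
qed (simp add: chain_cone_def)

lemma chain_boundary_chain_cone_0:
  assumes H0: "\<And>x. x \<in> topspace X \<Longrightarrow> H (0, x) = x"
    and c: "singular_chain 0 X c"
  shows "chain_boundary (Suc 0) (chain_cone H a 0 c) =
         c - frag_cmul (augmentation c) (frag_of (restrict (\<lambda>_. a) (standard_simplex 0)))"
  using c[unfolded singular_chain_def]
proof (induction c rule: frag_induction)
  case (one \<sigma>)
  then show ?case
    using singular_face_0_cone_simplex[where H = H and X = X and q = 0 and a = a, OF H0]
    by (simp add: chain_cone_def chain_boundary_of singular_face_1_cone_simplex_0 restrict_def)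
next
  case (diff c d)
  then show ?case
    by (simp add: chain_cone_def frag_extend_diff chain_boundary_diff augmentation_diff
        frag_cmul_diff_distrib algebra_simps)
qed (simp add: chain_cone_def)

lemma singular_chain_chain_cone:
  assumes H: "continuous_map (prod_topology (top_of_set {0..1}) X) X H"
    and H1: "\<And>x. x \<in> topspace X \<Longrightarrow> H (1, x) = a" and a: "a \<in> topspace X"
    and c: "singular_chain q X c"
  shows "singular_chain (Suc q) X (chain_cone H a q c)"
  unfolding chain_cone_def
  using c singular_simplex_cone_simplex[OF H H1 a]
  by (intro singular_chain_extend) (auto simp: singular_chain_of singular_chain_def)

lemma carrier_cochain_group:
  "\<phi> \<in> carrier (cochain_group q X) \<longleftrightarrow>
     \<phi> \<in> extensional (singular_chain_set q X) \<and>
     (\<forall>c d. singular_chain q X c \<longrightarrow> singular_chain q X d \<longrightarrow> \<phi> (c + d) = \<phi> c + \<phi> d)"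
  by (auto simp: cochain_group_def hom_def integer_group_def)

lemma mult_cochain_group:
  "\<phi> \<otimes>\<^bsub>cochain_group q X\<^esub> \<psi> = restrict (\<lambda>c. \<phi> c + \<psi> c) (singular_chain_set q X)"
  by (simp add: cochain_group_def)

lemma one_cochain_group:
  "\<one>\<^bsub>cochain_group q X\<^esub> = restrict (\<lambda>c. 0) (singular_chain_set q X)"
  by (simp add: cochain_group_def)

lemma group_cochain_group: "group (cochain_group q X)"
proof (rule groupI)
  fix \<phi> assume \<phi>: "\<phi> \<in> carrier (cochain_group q X)"
  let ?\<psi> = "restrict (\<lambda>c. - \<phi> c) (singular_chain_set q X)"
  have "?\<psi> \<in> carrier (cochain_group q X)"
    using \<phi> by (simp add: carrier_cochain_group singular_chain_add)
  moreover have "?\<psi> \<otimes>\<^bsub>cochain_group q X\<^esub> \<phi> = \<one>\<^bsub>cochain_group q X\<^esub>"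
    by (auto simp: mult_cochain_group one_cochain_group restrict_def)
  ultimately show "\<exists>\<psi>\<in>carrier (cochain_group q X). \<psi> \<otimes>\<^bsub>cochain_group q X\<^esub> \<phi> = \<one>\<^bsub>cochain_group q X\<^esub>"
    by blast
qed (auto simp: carrier_cochain_group mult_cochain_group one_cochain_group singular_chain_add
       extensional_def restrict_def)

lemma cocycle_iff:
  "\<phi> \<in> cocycle_set q X \<longleftrightarrow>
     \<phi> \<in> carrier (cochain_group q X) \<and>
     (\<forall>c. singular_chain (Suc q) X c \<longrightarrow> \<phi> (chain_boundary (Suc q) c) = 0)"
proof -
  have "coboundary q X \<phi> = \<one>\<^bsub>cochain_group (Suc q) X\<^esub> \<longleftrightarrow>
        (\<forall>c. singular_chain (Suc q) X c \<longrightarrow> \<phi> (chain_boundary (Suc q) c) = 0)"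
    by (auto simp: coboundary_def one_cochain_group fun_eq_iff restrict_def)
  then show ?thesis by (auto simp: cocycle_set_def)
qed

lemma cochain_diff:
  assumes "\<phi> \<in> carrier (cochain_group q X)" "singular_chain q X c" "singular_chain q X d"
  shows "\<phi> (c - d) = \<phi> c - \<phi> d"
proof -
  have "\<phi> (c - d + d) = \<phi> (c - d) + \<phi> d"
    using assms(1)[unfolded carrier_cochain_group] singular_chain_diff[OF assms(2,3)] assms(3)
    by blast
  then show ?thesis by simp
qed

lemma cochain_0:
  assumes "\<phi> \<in> carrier (cochain_group q X)"
  shows "\<phi> 0 = 0"
  using cochain_diff[OF assms, of 0 0] by simp

text \<open>Cochains are only assumed additive; linearity over the integers is a consequence.\<close>
lemma cochain_cmul:
  assumes \<phi>: "\<phi> \<in> carrier (cochain_group q X)" and c: "singular_chain q X c"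
  shows "\<phi> (frag_cmul m c) = m * \<phi> c"
proof -
  have nat: "\<phi> (frag_cmul (int n) c) = int n * \<phi> c" for n
  proof (induction n)
    case 0
    show ?case by (simp add: cochain_0[OF \<phi>])
  next
    case (Suc n)
    have "\<phi> (frag_cmul (int n) c + c) = \<phi> (frag_cmul (int n) c) + \<phi> c"
      using \<phi> c by (auto simp: carrier_cochain_group singular_chain_cmul)
    then show ?case
      using Suc by (simp add: frag_cmul_distrib algebra_simps)
  qed
  show ?thesis
  proof (cases "0 \<le> m")
    case True
    then show ?thesis using nat[of "nat m"] by simp
  next
    case False
    have "\<phi> (0 - frag_cmul (- m) c) = \<phi> 0 - \<phi> (frag_cmul (- m) c)"
      using \<phi> c by (intro cochain_diff) (auto simp: singular_chain_cmul)
    then show ?thesis using nat[of "nat (- m)"] False by (simp add: cochain_0[OF \<phi>])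
  qed
qed

lemma reduced_coboundary_subset_cocycle: "reduced_coboundary_set q X \<subseteq> cocycle_set q X"
proof (cases q)
  case 0
  then show ?thesis
    by (auto simp: reduced_coboundary_set_def cocycle_iff carrier_cochain_group augmentation_add
        augmentation_boundary singular_chain_add singular_chain_boundary_alt algebra_simps)
next
  case (Suc p)
  show ?thesis
  proof
    fix \<phi> assume "\<phi> \<in> reduced_coboundary_set q X"
    then obtain \<psi> where \<psi>: "\<psi> \<in> carrier (cochain_group p X)" and \<phi>: "\<phi> = coboundary p X \<psi>"
      by (auto simp: reduced_coboundary_set_def Suc)
    have "\<psi> (chain_boundary (Suc p) (chain_boundary (Suc (Suc p)) c)) = 0"
      if "singular_chain (Suc (Suc p)) X c" for c
      using chain_boundary_boundary_alt[OF that] cochain_0[OF \<psi>] by simp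
    moreover have "\<psi> (chain_boundary (Suc p) (c + d)) =
        \<psi> (chain_boundary (Suc p) c) + \<psi> (chain_boundary (Suc p) d)"
      if "singular_chain (Suc p) X c" "singular_chain (Suc p) X d" for c d
      using \<psi> that by (auto simp: carrier_cochain_group chain_boundary_add singular_chain_boundary_alt)
    ultimately show "\<phi> \<in> cocycle_set q X"
      by (auto simp: cocycle_iff carrier_cochain_group \<phi> coboundary_def Suc singular_chain_add
          singular_chain_boundary_alt)
  qed
qed

text \<open>
  If \<open>\<phi>\<close> is a cocycle then \<open>\<phi>\<close> vanishes on \<open>\<partial>Dc = c - D\<partial>c\<close>, where \<open>D\<close> is the cone operator.
  Hence \<open>\<phi>(c) = \<phi>(D\<partial>c)\<close>, which exhibits \<open>\<phi>\<close> as the coboundary of \<open>\<phi> \<circ> D\<close>. In degree \<open>0\<close> the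
  correction term makes \<open>\<phi>\<close> a multiple of the augmentation instead.
\<close>
lemma cocycle_subset_reduced_coboundary:
  assumes contr: "contractible_space X" and ne: "topspace X \<noteq> {}"
  shows "cocycle_set q X \<subseteq> reduced_coboundary_set q X"
proof
  obtain a H where H: "continuous_map (prod_topology (top_of_set {0..1::real}) X) X H"
    and H0: "\<And>x. H (0, x) = x" and H1: "\<And>x. H (1, x) = a"
    using contr unfolding contractible_space_def homotopic_with_def by auto
  have a: "a \<in> topspace X"
  proof -
    from ne obtain x where "x \<in> topspace X" by blast
    then have "H (1, x) \<in> topspace X"
      using continuous_map_image_subset_topspace[OF H] by force
    then show ?thesis by (simp add: H1)
  qed
  note cone = singular_chain_chain_cone[OF H H1 a]
  fix \<phi> assume "\<phi> \<in> cocycle_set q X"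
  then have \<phi>: "\<phi> \<in> carrier (cochain_group q X)"
    and cocycle: "\<And>c. singular_chain (Suc q) X c \<Longrightarrow> \<phi> (chain_boundary (Suc q) c) = 0"
    by (auto simp: cocycle_iff)
  have ext: "\<phi> \<in> extensional (singular_chain_set q X)"
    using \<phi> by (simp add: carrier_cochain_group)
  show "\<phi> \<in> reduced_coboundary_set q X"
  proof (cases q)
    case 0
    let ?pt = "restrict (\<lambda>_. a) (standard_simplex 0)"
    have pt: "singular_chain 0 X (frag_of ?pt)"
      using a by (simp add: singular_chain_of singular_simplex_def)
    have "\<phi> c = \<phi> (frag_of ?pt) * augmentation c" if c: "singular_chain 0 X c" for c
    proof -
      have "0 = \<phi> (c - frag_cmul (augmentation c) (frag_of ?pt))"
        using cocycle[of "chain_cone H a 0 c"] cone[OF c] c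
        by (simp add: 0 chain_boundary_chain_cone_0[of X H, OF H0])
      also have "\<dots> = \<phi> c - augmentation c * \<phi> (frag_of ?pt)"
        using \<phi> c pt unfolding 0
        by (subst cochain_diff[of _ 0 X]) (auto simp: singular_chain_cmul cochain_cmul[of _ 0 X])
      finally show ?thesis by (simp add: mult.commute)
    qed
    then have "\<phi> = restrict (\<lambda>c. \<phi> (frag_of ?pt) * augmentation c) (singular_chain_set 0 X)"
      using ext by (intro extensionalityI[of _ "singular_chain_set 0 X"]) (auto simp: 0)
    then show ?thesis by (auto simp: reduced_coboundary_set_def 0)
  next
    case (Suc p)
    define \<psi> where "\<psi> = restrict (\<lambda>c. \<phi> (chain_cone H a p c)) (singular_chain_set p X)"
    have "\<psi> \<in> carrier (cochain_group p X)"
      using \<phi> cone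
      by (auto simp: carrier_cochain_group \<psi>_def Suc singular_chain_add chain_cone_def frag_extend_add)
    moreover have "\<phi> = coboundary p X \<psi>"
    proof (rule extensionalityI[of _ "singular_chain_set q X"])
      fix c assume "c \<in> singular_chain_set q X"
      then have c: "singular_chain (Suc p) X c" by (simp add: Suc)
      have bc: "singular_chain p X (chain_boundary (Suc p) c)"
        using c by (rule singular_chain_boundary_alt)
      have "0 = \<phi> (c - chain_cone H a p (chain_boundary (Suc p) c))"
        using cocycle[of "chain_cone H a (Suc p) c"] cone[OF c] c
        by (simp add: Suc chain_boundary_chain_cone[of X H, OF H0])
      also have "\<dots> = \<phi> c - \<phi> (chain_cone H a p (chain_boundary (Suc p) c))"
        using \<phi> c cone[OF bc] by (intro cochain_diff[of _ q X]) (auto simp: Suc)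
      finally show "\<phi> c = coboundary p X \<psi> c"
        using c bc by (simp add: coboundary_def \<psi>_def)
    qed (use ext in \<open>auto simp: coboundary_def Suc\<close>)
    ultimately show ?thesis by (auto simp: reduced_coboundary_set_def Suc)
  qed
qed

lemma (in group) trivial_group_Mod_carrier: "trivial_group (G Mod carrier G)"
proof -
  have "carrier G \<lhd> G"
    by (simp add: normal_inv_iff subgroup_self)
  then interpret normal "carrier G" G .
  have "carrier (G Mod carrier G) \<subseteq> {carrier G}"
    by (auto simp: FactGroup_def RCOSETS_def coset_join2[OF _ subgroup_self])
  then show ?thesis
    using group.trivial_group_alt[OF factorgroup_is_group] by blast
qed

theorem trivial_reduced_cohomology_contractible:
  assumes "contractible_space X" "topspace X \<noteq> {}"
  shows "trivial_group (reduced_cohomology_group q X)"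
proof -
  interpret group "cochain_group q X" by (rule group_cochain_group)
  have "subgroup (cocycle_set q X) (cochain_group q X)"
  proof (rule subgroupI)
    show "cocycle_set q X \<noteq> {}"
      using one_closed by (force simp: cocycle_iff one_cochain_group singular_chain_boundary_alt)
    fix \<phi> assume \<phi>: "\<phi> \<in> cocycle_set q X"
    then have c\<phi>: "\<phi> \<in> carrier (cochain_group q X)" by (simp add: cocycle_iff)
    let ?\<psi> = "restrict (\<lambda>c. - \<phi> c) (singular_chain_set q X)"
    have "inv\<^bsub>cochain_group q X\<^esub> \<phi> = ?\<psi>"
    proof (rule inv_equality)
      show "?\<psi> \<otimes>\<^bsub>cochain_group q X\<^esub> \<phi> = \<one>\<^bsub>cochain_group q X\<^esub>"
        by (auto simp: mult_cochain_group one_cochain_group restrict_def)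
      show "?\<psi> \<in> carrier (cochain_group q X)"
        using c\<phi> by (simp add: carrier_cochain_group singular_chain_add)
    qed (rule c\<phi>)
    then show "inv\<^bsub>cochain_group q X\<^esub> \<phi> \<in> cocycle_set q X"
      using \<phi> inv_closed[OF c\<phi>] by (simp add: cocycle_iff singular_chain_boundary_alt)
    fix \<psi> assume \<psi>: "\<psi> \<in> cocycle_set q X"
    then have "\<phi> \<otimes>\<^bsub>cochain_group q X\<^esub> \<psi> \<in> carrier (cochain_group q X)"
      using c\<phi> by (simp add: cocycle_iff)
    then show "\<phi> \<otimes>\<^bsub>cochain_group q X\<^esub> \<psi> \<in> cocycle_set q X"
      using \<phi> \<psi> by (simp add: cocycle_iff) (simp add: mult_cochain_group singular_chain_boundary_alt)
  qed (auto simp: cocycle_iff)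
  then have carrier: "carrier (subgroup_generated (cochain_group q X) (cocycle_set q X)) =
                      cocycle_set q X"
    by (rule subgroup.carrier_subgroup_generated_subgroup)
  have "reduced_coboundary_set q X = cocycle_set q X"
    using reduced_coboundary_subset_cocycle cocycle_subset_reduced_coboundary[OF assms] by blast
  then have "reduced_cohomology_group q X =
        subgroup_generated (cochain_group q X) (cocycle_set q X) Mod
        carrier (subgroup_generated (cochain_group q X) (cocycle_set q X))"
    unfolding reduced_cohomology_group_def carrier by simp
  then show ?thesis
    using group.trivial_group_Mod_carrier[OF group_subgroup_generated] by simp
qed

section \<open>The ring of holomorphic germs and pullback to a branch\<close>

lemma holo_at_0_cases:
  assumes "f \<in> holo_at_0"
  obtains U where "open U" "0 \<in> U" "mholomorphic_on f U"
  using assms by (auto simp: holo_at_0_def)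



lemma holo_at_0_const: "(\<lambda>x. c) \<in> holo_at_0"
proof -
  have "mholomorphic_on (\<lambda>x. c) UNIV"
    unfolding mholomorphic_on_def by (intro ballI exI[of _ "\<lambda>h. 0"]) auto
  then show ?thesis unfolding holo_at_0_def by blast
qed

lemma holo_at_0_add:
  assumes "f \<in> holo_at_0" "g \<in> holo_at_0"
  shows "(\<lambda>x. f x + g x) \<in> holo_at_0"
proof -
  from assms obtain U V where U: "open U" "0 \<in> U" "mholomorphic_on f U"
    and V: "open V" "0 \<in> V" "mholomorphic_on g V"
    by (auto simp: holo_at_0_def)
  have "mholomorphic_on (\<lambda>x. f x + g x) (U \<inter> V)"
    unfolding mholomorphic_on_def
  proof
    fix x assume x: "x \<in> U \<inter> V"
    then obtain f' g' where f': "(f has_derivative f') (at x)" "\<forall>c v. f' (c *s v) = c * f' v"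
      and g': "(g has_derivative g') (at x)" "\<forall>c v. g' (c *s v) = c * g' v"
      using U(3) V(3) unfolding mholomorphic_on_def by blast
    show "\<exists>d. ((\<lambda>x. f x + g x) has_derivative d) (at x) \<and> (\<forall>c v. d (c *s v) = c * d v)"
      using f' g' by (intro exI[of _ "\<lambda>h. f' h + g' h"]) (auto intro!: derivative_eq_intros simp: algebra_simps)
  qed
  then show ?thesis using U V unfolding holo_at_0_def by blast
qed

lemma holo_at_0_mult:
  assumes "f \<in> holo_at_0" "g \<in> holo_at_0"
  shows "(\<lambda>x. f x * g x) \<in> holo_at_0"
proof -
  from assms obtain U V where U: "open U" "0 \<in> U" "mholomorphic_on f U"
    and V: "open V" "0 \<in> V" "mholomorphic_on g V"
    by (auto simp: holo_at_0_def)
  have "mholomorphic_on (\<lambda>x. f x * g x) (U \<inter> V)"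
    unfolding mholomorphic_on_def
  proof
    fix x assume x: "x \<in> U \<inter> V"
    then obtain f' g' where f': "(f has_derivative f') (at x)" "\<forall>c v. f' (c *s v) = c * f' v"
      and g': "(g has_derivative g') (at x)" "\<forall>c v. g' (c *s v) = c * g' v"
      using U(3) V(3) unfolding mholomorphic_on_def by blast
    show "\<exists>d. ((\<lambda>x. f x * g x) has_derivative d) (at x) \<and> (\<forall>c v. d (c *s v) = c * d v)"
      using f'(2) g'(2) has_derivative_mult[OF f'(1) g'(1)]
      by (intro exI[of _ "\<lambda>h. f x * g' h + f' h * g x"]) (auto simp: algebra_simps)
  qed
  then show ?thesis using U V unfolding holo_at_0_def by blast
qed

lemma holo_at_0_uminus: "f \<in> holo_at_0 \<Longrightarrow> (\<lambda>x. - f x) \<in> holo_at_0"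
  using holo_at_0_mult[OF holo_at_0_const[of "- 1"], of f] by simp

lemma holo_at_0_power: "f \<in> holo_at_0 \<Longrightarrow> (\<lambda>x. f x ^ n) \<in> holo_at_0"
  by (induction n) (auto simp: holo_at_0_const holo_at_0_mult)

text \<open>
  The part of the definition of a normalization that makes pullback of germs along \<open>\<nu>\<close>
  well defined. Unlike normalizations, arcs in a branch are also arcs in the whole curve.
\<close>
definition analytic_arc :: "(complex^'n) set \<Rightarrow> (complex \<Rightarrow> complex^'n) \<Rightarrow> bool" where
  "analytic_arc X \<nu> \<longleftrightarrow>
     (\<forall>k. (\<lambda>t. \<nu> t $ k) analytic_on {0}) \<and> \<nu> 0 = 0 \<and> (\<forall>\<^sub>F t in nhds 0. \<nu> t \<in> X)"

lemma has_derivative_vec_lambda: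
  fixes f :: "'n::finite \<Rightarrow> complex \<Rightarrow> complex"
  assumes "\<And>k. (f k has_derivative f' k) (at t)"
  shows "((\<lambda>t. \<chi> k. f k t) has_derivative (\<lambda>h. \<chi> k. f' k h)) (at t)"
proof -
  have axis: "bounded_linear (axis k :: complex \<Rightarrow> complex^'n)" for k
    unfolding linear_conv_bounded_linear[symmetric]
    by (rule linearI) (auto simp: vec_eq_iff axis_def)
  have eq: "(\<chi> k. g k) = (\<Sum>k\<in>UNIV. axis k (g k))" for g :: "'n \<Rightarrow> complex"
    by (simp add: vec_eq_iff axis_def sum_component if_distrib if_distribR cong: if_cong)
  show ?thesis
    unfolding eq by (intro has_derivative_sum bounded_linear.has_derivative[OF axis] assms)
qed

text \<open>
  Chain rule: the derivative of \<open>f \<circ> \<nu>\<close> is complex linear because that of \<open>f\<close> is, so \<open>f \<circ> \<nu>\<close> is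
  complex differentiable near \<open>0\<close>.
\<close>
lemma analytic_arc_compose:
  assumes arc: "analytic_arc X \<nu>" and f: "f \<in> holo_at_0"
  shows "(f \<circ> \<nu>) analytic_on {0}"
proof -
  have "\<forall>k. \<exists>S. open S \<and> 0 \<in> S \<and> (\<lambda>t. \<nu> t $ k) holomorphic_on S"
    using arc by (simp add: analytic_arc_def analytic_at)
  then obtain S where S: "\<And>k. open (S k)" "\<And>k. 0 \<in> S k" "\<And>k. (\<lambda>t. \<nu> t $ k) holomorphic_on S k"
    by metis
  define T where "T = (\<Inter>k. S k)"
  have T: "open T" "0 \<in> T" "\<And>k. (\<lambda>t. \<nu> t $ k) holomorphic_on T"
    using S by (auto simp: T_def intro: holomorphic_on_subset)
  have "continuous_on T (\<lambda>t. \<chi> k. \<nu> t $ k)"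
    using T(3) by (intro continuous_on_vec_lambda holomorphic_on_imp_continuous_on)
  then have cont: "continuous_on T \<nu>" by simp
  from f obtain U where U: "open U" "0 \<in> U" "mholomorphic_on f U"
    by (rule holo_at_0_cases)
  define W where "W = T \<inter> \<nu> -` U"
  have W: "open W" "0 \<in> W"
    using continuous_open_preimage[OF cont T(1) U(1)] T(2) U(2) arc
    by (auto simp: W_def analytic_arc_def)
  have "(f \<circ> \<nu>) field_differentiable (at t)" if t: "t \<in> W" for t
  proof -
    have "\<exists>d. ((\<lambda>t. \<nu> t $ k) has_field_derivative d) (at t)" for k
      using T(1,3) t by (auto simp: W_def field_differentiable_def[symmetric]
          intro: holomorphic_on_imp_differentiable_at)
    then obtain d where d: "\<And>k. ((\<lambda>t. \<nu> t $ k) has_field_derivative d k) (at t)"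
      by metis
    then have "((\<lambda>t. \<chi> k. \<nu> t $ k) has_derivative (\<lambda>h. \<chi> k. d k * h)) (at t)"
      by (intro has_derivative_vec_lambda) (simp add: has_field_derivative_def)
    then have \<nu>': "(\<nu> has_derivative (\<lambda>h. \<chi> k. d k * h)) (at t)" by simp
    obtain f' where f': "(f has_derivative f') (at (\<nu> t))" "\<forall>c v. f' (c *s v) = c * f' v"
      using U(3) t unfolding mholomorphic_on_def W_def by blast
    have lin: "f' (\<chi> k. d k * h) = f' (\<chi> k. d k) * h" for h
    proof -
      have "(\<chi> k. d k * h) = h *s (\<chi> k. d k)" by (simp add: vec_eq_iff mult.commute)
      then show ?thesis using f'(2) by (simp add: mult.commute)
    qed
    have "(f \<circ> \<nu> has_derivative (f' \<circ> (\<lambda>h. \<chi> k. d k * h))) (at t)"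
      using diff_chain_at[OF \<nu>' f'(1)] .
    then have "((f \<circ> \<nu>) has_field_derivative f' (\<chi> k. d k)) (at t)"
      by (simp add: has_field_derivative_def o_def lin)
    then show ?thesis by (auto simp: field_differentiable_def)
  qed
  then have "(f \<circ> \<nu>) holomorphic_on W"
    by (simp add: holomorphic_on_def field_differentiable_at_within)
  then show ?thesis
    using W by (auto simp: analytic_at)
qed

definition pull :: "(complex \<Rightarrow> complex^'n) \<Rightarrow> (complex^'n \<Rightarrow> complex) \<Rightarrow> complex fps" where
  "pull \<nu> f = fps_expansion (f \<circ> \<nu>) 0"

lemma pull_eqI: "(f \<circ> \<nu>) has_fps_expansion F \<Longrightarrow> pull \<nu> f = F"
  unfolding pull_def by (rule fps_expansion_eqI)

lemma pull_has_expansion: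
  "analytic_arc X \<nu> \<Longrightarrow> f \<in> holo_at_0 \<Longrightarrow> (f \<circ> \<nu>) has_fps_expansion pull \<nu> f"
  unfolding pull_def by (intro analytic_at_imp_has_fps_expansion_0 analytic_arc_compose)

lemma pull_add:
  assumes "analytic_arc X \<nu>" "f \<in> holo_at_0" "g \<in> holo_at_0"
  shows "pull \<nu> (\<lambda>x. f x + g x) = pull \<nu> f + pull \<nu> g"
  using has_fps_expansion_add[OF pull_has_expansion[OF assms(1,2)] pull_has_expansion[OF assms(1,3)]]
  by (intro pull_eqI) (simp add: o_def)

lemma pull_mult:
  assumes "analytic_arc X \<nu>" "f \<in> holo_at_0" "g \<in> holo_at_0"
  shows "pull \<nu> (\<lambda>x. f x * g x) = pull \<nu> f * pull \<nu> g"
  using has_fps_expansion_mult[OF pull_has_expansion[OF assms(1,2)] pull_has_expansion[OF assms(1,3)]]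
  by (intro pull_eqI) (simp add: o_def)

lemma pull_const: "pull \<nu> (\<lambda>x. c) = fps_const c"
  by (intro pull_eqI) (simp add: o_def)

lemma pull_power:
  assumes "analytic_arc X \<nu>" "f \<in> holo_at_0"
  shows "pull \<nu> (\<lambda>x. f x ^ n) = pull \<nu> f ^ n"
  by (induction n) (auto simp: pull_const pull_mult[OF assms(1)] assms holo_at_0_power)

lemma pull_uminus:
  assumes "analytic_arc X \<nu>" "f \<in> holo_at_0"
  shows "pull \<nu> (\<lambda>x. - f x) = - pull \<nu> f"
  using pull_mult[OF assms(1) holo_at_0_const[of "- 1"] assms(2)]
  by (simp add: pull_const flip: fps_const_neg)

lemma pull_nth_0:
  assumes "analytic_arc X \<nu>" "f \<in> holo_at_0"
  shows "fps_nth (pull \<nu> f) 0 = f 0"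
  using has_fps_expansion_imp_0_eq_fps_nth_0[OF pull_has_expansion[OF assms]] assms(1)
  by (simp add: analytic_arc_def)

lemma analytic_arc_tendsto:
  assumes "analytic_arc X \<nu>"
  shows "filterlim \<nu> (nhds 0) (nhds 0)"
proof -
  have "\<forall>k. (\<lambda>t. \<nu> t $ k) analytic_on {0}" using assms(1) by (simp add: analytic_arc_def)
  then have "\<forall>k. isCont (\<lambda>t. \<nu> t $ k) 0"
    by (simp add: analytic_at_imp_isCont)
  then have "isCont (\<lambda>t. \<chi> k. \<nu> t $ k) 0"
    unfolding isCont_def by (intro tendsto_vec_lambda) auto
  then have "isCont \<nu> 0" by simp
  then show ?thesis
    using assms(1) by (simp add: analytic_arc_def isCont_def tendsto_nhds_iff)
qed

lemma pull_vanishing: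
  assumes "analytic_arc X \<nu>" "\<forall>\<^sub>F x in nhds 0. x \<in> X \<longrightarrow> f x = 0"
  shows "pull \<nu> f = 0"
proof (rule pull_eqI)
  have "\<forall>\<^sub>F t in nhds 0. \<nu> t \<in> X \<longrightarrow> f (\<nu> t) = 0"
    using assms(2) analytic_arc_tendsto[OF assms(1)] by (auto simp: filterlim_iff)
  moreover have "\<forall>\<^sub>F t in nhds 0. \<nu> t \<in> X" using assms(1) by (simp add: analytic_arc_def)
  ultimately have "\<forall>\<^sub>F t in nhds 0. (f \<circ> \<nu>) t = 0"
    by eventually_elim simp
  then show "(f \<circ> \<nu>) has_fps_expansion 0"
    by (simp add: has_fps_expansion_0_iff)
qed

lemma holo_ring_simps [simp]:
  "carrier holo_ring = holo_at_0" "f \<otimes>\<^bsub>holo_ring\<^esub> g = (\<lambda>x. f x * g x)"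
  "f \<oplus>\<^bsub>holo_ring\<^esub> g = (\<lambda>x. f x + g x)" "\<one>\<^bsub>holo_ring\<^esub> = (\<lambda>x. 1)" "\<zero>\<^bsub>holo_ring\<^esub> = (\<lambda>x. 0)"
  by (simp_all add: holo_ring_def)

lemma cring_holo_ring: "cring (holo_ring :: (complex^'n \<Rightarrow> complex) ring)"
proof (rule cringI)
  show "abelian_group (holo_ring :: (complex^'n \<Rightarrow> complex) ring)"
  proof (rule abelian_groupI)
    fix f :: "complex^'n \<Rightarrow> complex" assume "f \<in> carrier holo_ring"
    then show "\<exists>g\<in>carrier holo_ring. g \<oplus>\<^bsub>holo_ring\<^esub> f = \<zero>\<^bsub>holo_ring\<^esub>"
      by (intro bexI[of _ "\<lambda>x. - f x"]) (auto simp: holo_at_0_uminus)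
  qed (auto simp: holo_at_0_add holo_at_0_const algebra_simps)
  show "comm_monoid (holo_ring :: (complex^'n \<Rightarrow> complex) ring)"
    by (rule comm_monoidI) (auto simp: holo_at_0_mult holo_at_0_const algebra_simps)
qed (auto simp: algebra_simps)

lemma ideal_vanishing_ideal:
  fixes X :: "(complex^'n) set"
  shows "ideal (vanishing_ideal X) holo_ring"
proof (rule idealI)
  show ring: "ring (holo_ring :: (complex^'n \<Rightarrow> complex) ring)"
    using cring_holo_ring by (rule cring.axioms(1))
  then interpret ring "holo_ring :: (complex^'n \<Rightarrow> complex) ring" .
  show "subgroup (vanishing_ideal X) (add_monoid holo_ring)"
  proof (rule add.subgroupI)
    show "vanishing_ideal X \<subseteq> carrier holo_ring" by (auto simp: vanishing_ideal_def)
    have "(\<lambda>x. 0) \<in> vanishing_ideal X" by (simp add: vanishing_ideal_def holo_at_0_const)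
    then show "vanishing_ideal X \<noteq> {}" by blast
    fix f assume f: "f \<in> vanishing_ideal X"
    then have fc: "f \<in> holo_at_0" by (simp add: vanishing_ideal_def)
    have "\<ominus>\<^bsub>holo_ring\<^esub> f = (\<lambda>x. - f x)"
      using fc by (intro minus_equality) (auto simp: holo_at_0_uminus)
    then show "\<ominus>\<^bsub>holo_ring\<^esub> f \<in> vanishing_ideal X"
      using f by (simp add: vanishing_ideal_def holo_at_0_uminus)
    fix g assume g: "g \<in> vanishing_ideal X"
    from f g have "\<forall>\<^sub>F x in nhds 0. x \<in> X \<longrightarrow> f x = 0" "\<forall>\<^sub>F x in nhds 0. x \<in> X \<longrightarrow> g x = 0"
      by (simp_all add: vanishing_ideal_def)
    then have "\<forall>\<^sub>F x in nhds 0. x \<in> X \<longrightarrow> f x + g x = 0"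
      by eventually_elim simp
    then show "f \<oplus>\<^bsub>holo_ring\<^esub> g \<in> vanishing_ideal X"
      using f g by (simp add: vanishing_ideal_def holo_at_0_add)
  qed
  fix f g :: "complex^'n \<Rightarrow> complex"
  assume fg: "f \<in> vanishing_ideal X" "g \<in> carrier holo_ring"
  then have "\<forall>\<^sub>F x in nhds 0. x \<in> X \<longrightarrow> f x = 0"
    by (simp add: vanishing_ideal_def)
  then have "\<forall>\<^sub>F x in nhds 0. x \<in> X \<longrightarrow> f x * g x = 0" "\<forall>\<^sub>F x in nhds 0. x \<in> X \<longrightarrow> g x * f x = 0"
    by (eventually_elim, simp)+
  then show "g \<otimes>\<^bsub>holo_ring\<^esub> f \<in> vanishing_ideal X" "f \<otimes>\<^bsub>holo_ring\<^esub> g \<in> vanishing_ideal X"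
    using fg by (auto simp: vanishing_ideal_def holo_at_0_mult)
qed

abbreviation restrict_germ ::
  "(complex^'n) set \<Rightarrow> (complex^'n \<Rightarrow> complex) \<Rightarrow> (complex^'n \<Rightarrow> complex) set" where
  "restrict_germ X f \<equiv> vanishing_ideal X +>\<^bsub>holo_ring\<^esub> f"

lemma restrict_germ_hom: "ring_hom_ring holo_ring (local_ring X) (restrict_germ X)"
  unfolding local_ring_def by (rule ideal.rcos_ring_hom_ring[OF ideal_vanishing_ideal])

lemma carrier_local_ring: "carrier (local_ring X) = restrict_germ X ` holo_at_0"
  by (auto simp: local_ring_def FactRing_def A_RCOSETS_def' )

lemma germ_pullback_restrict:
  assumes arc: "analytic_arc X \<nu>" and f: "f \<in> holo_at_0"
  shows "germ_pullback \<nu> (restrict_germ X f) = pull \<nu> f"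
proof -
  have coset: "restrict_germ X f = {(\<lambda>x. h x + f x) | h. h \<in> vanishing_ideal X}"
    by (auto simp: a_r_coset_def' )
  have "pull \<nu> (\<lambda>x. h x + f x) = pull \<nu> f" if "h \<in> vanishing_ideal X" for h
    using that pull_add[OF arc _ f, of h] pull_vanishing[OF arc, of h]
    by (simp add: vanishing_ideal_def)
  moreover have "(\<lambda>x. 0) \<in> vanishing_ideal X"
    by (simp add: vanishing_ideal_def holo_at_0_const)
  ultimately have "pull \<nu> ` restrict_germ X f = {pull \<nu> f}"
    unfolding coset by force
  then show ?thesis by (simp add: germ_pullback_def pull_def)
qed

lemma is_normalization_arc: "is_normalization X \<nu> \<Longrightarrow> analytic_arc X \<nu>"
  by (simp add: is_normalization_def analytic_arc_def)

text \<open>The nontrivial direction is the injectivity of the pullback on the local ring of the branch.\<close>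
lemma normalization_pull_eq_0_iff:
  assumes "is_normalization X \<nu>" "f \<in> holo_at_0"
  shows "pull \<nu> f = 0 \<longleftrightarrow> (\<forall>\<^sub>F x in nhds 0. x \<in> X \<longrightarrow> f x = 0)"
proof
  note arc = is_normalization_arc[OF assms(1)]
  interpret ideal "vanishing_ideal X" holo_ring by (rule ideal_vanishing_ideal)
  assume "pull \<nu> f = 0"
  then have "germ_pullback \<nu> (restrict_germ X f) = germ_pullback \<nu> (restrict_germ X (\<lambda>x. 0))"
    by (simp add: germ_pullback_restrict[OF arc] assms(2) holo_at_0_const pull_const)
  moreover have "inj_on (germ_pullback \<nu>) (carrier (local_ring X))"
    using assms(1) by (simp add: is_normalization_def)
  ultimately have "restrict_germ X f = restrict_germ X (\<lambda>x. 0)"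
    using assms(2) holo_at_0_const by (auto simp: inj_on_def carrier_local_ring)
  moreover have "f \<in> restrict_germ X f"
    using a_rcos_self[of f] assms(2) by simp
  moreover have "restrict_germ X (\<lambda>x. 0) = vanishing_ideal X"
    using a_rcos_zero[OF is_ideal] additive_subgroup.zero_closed[OF is_additive_subgroup] by simp
  ultimately show "\<forall>\<^sub>F x in nhds 0. x \<in> X \<longrightarrow> f x = 0"
    by (simp add: vanishing_ideal_def)
qed (rule pull_vanishing[OF is_normalization_arc[OF assms(1)]])

text \<open>
  The parameter \<open>t\<close> is a quotient of two elements of the local ring of the branch, so that two
  consecutive numbers occur as orders. This is the source of the conductor.
\<close>
lemma normalization_consecutive_orders:
  assumes "is_normalization X \<nu>"
  obtains a b where "a \<in> holo_at_0" "b \<in> holo_at_0" "pull \<nu> a \<noteq> 0" "pull \<nu> b \<noteq> 0"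
    "subdegree (pull \<nu> a) = Suc (subdegree (pull \<nu> b))"
proof -
  note arc = is_normalization_arc[OF assms]
  let ?A = "(\<lambda>g. fps_to_fls (germ_pullback \<nu> g)) ` carrier (local_ring X)"
  have A: "?A = (\<lambda>f. fps_to_fls (pull \<nu> f)) ` holo_at_0"
    by (simp add: carrier_local_ring image_image germ_pullback_restrict[OF arc] cong: image_cong)
  have "fps_X \<in> convergent_series"
    by (simp add: convergent_series_def)
  then have "fps_to_fls fps_X \<in> fps_to_fls ` convergent_series" by (rule imageI)
  also have "fps_to_fls ` convergent_series = {q \<in> fractions ?A. integral_over ?A q}"
    using assms by (simp only: is_normalization_def Let_def)
  finally have "fps_to_fls fps_X \<in> fractions ?A" by (simp only: mem_Collect_eq)
  then obtain a b where ab: "a \<in> holo_at_0" "b \<in> holo_at_0" "fps_to_fls (pull \<nu> b) \<noteq> 0"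
    "fps_to_fls fps_X = fps_to_fls (pull \<nu> a) / fps_to_fls (pull \<nu> b)"
    unfolding A by (auto simp: fractions_def)
  then have "fps_to_fls (pull \<nu> a) = fps_to_fls (fps_X * pull \<nu> b)"
    by (simp add: fls_times_fps_to_fls field_simps)
  then have a: "pull \<nu> a = fps_X * pull \<nu> b" by simp
  have b: "pull \<nu> b \<noteq> 0" using ab(3) by simp
  then have "pull \<nu> a \<noteq> 0" "subdegree (pull \<nu> a) = Suc (subdegree (pull \<nu> b))"
    by (simp_all add: a)
  with b show ?thesis using ab(1,2) that by blast
qed

section \<open>The Hilbert function counts jumps\<close>

lemma subfield_constants: "subfield (range (\<lambda>c x. c)) (holo_ring :: (complex^'n \<Rightarrow> complex) ring)"
proof -
  let ?R = "holo_ring :: (complex^'n \<Rightarrow> complex) ring"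
  let ?K = "range (\<lambda>c x. c) :: (complex^'n \<Rightarrow> complex) set"
  interpret cring ?R by (rule cring_holo_ring)
  have "subring ?K ?R"
  proof (rule subringI)
    fix h assume "h \<in> ?K"
    then obtain c where h: "h = (\<lambda>x. c)" by blast
    have "\<ominus>\<^bsub>?R\<^esub> h = (\<lambda>x. - c)"
      unfolding h by (intro minus_equality) (auto simp: holo_at_0_const)
    then show "\<ominus>\<^bsub>?R\<^esub> h \<in> ?K" by blast
  qed (auto simp: holo_at_0_const)
  then have sub: "subcring ?K ?R" by (rule subcringI')
  have "Units (?R\<lparr>carrier := ?K\<rparr>) = ?K - {\<zero>\<^bsub>?R\<^esub>}"
  proof
    show "Units (?R\<lparr>carrier := ?K\<rparr>) \<subseteq> ?K - {\<zero>\<^bsub>?R\<^esub>}"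
      by (auto simp: Units_def fun_eq_iff)
    show "?K - {\<zero>\<^bsub>?R\<^esub>} \<subseteq> Units (?R\<lparr>carrier := ?K\<rparr>)"
    proof
      fix h assume "h \<in> ?K - {\<zero>\<^bsub>?R\<^esub>}"
      then obtain c where h: "h = (\<lambda>x. c)" "c \<noteq> 0" by auto
      then show "h \<in> Units (?R\<lparr>carrier := ?K\<rparr>)"
        unfolding Units_def by (auto simp: fun_eq_iff intro!: exI[of _ "1 / c"])
    qed
  qed
  then show ?thesis by (rule subfieldI[OF sub])
qed

lemma (in ring_hom_ring) image_ideal:
  assumes I: "ideal I R" and surj: "h ` carrier R = carrier S"
  shows "ideal (h ` I) S"
proof (rule idealI)
  show "ring S" by (rule S.ring_axioms)
  interpret I: ideal I R by (rule I)
  have I_sub: "I \<subseteq> carrier R" using I.Icarr by blast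
  show "subgroup (h ` I) (add_monoid S)"
  proof (rule S.add.subgroupI)
    show "h ` I \<subseteq> carrier S" using I_sub by auto
    show "h ` I \<noteq> {}" using I.zero_closed by blast
    fix y assume "y \<in> h ` I"
    then obtain a where a: "a \<in> I" "y = h a" by blast
    then have "\<ominus>\<^bsub>S\<^esub> y = h (\<ominus>\<^bsub>R\<^esub> a)" using I_sub by (simp add: subset_iff)
    then show "\<ominus>\<^bsub>S\<^esub> y \<in> h ` I" using a I.a_inv_closed by blast
    fix z assume "z \<in> h ` I"
    then obtain b where b: "b \<in> I" "z = h b" by blast
    then have "y \<oplus>\<^bsub>S\<^esub> z = h (a \<oplus>\<^bsub>R\<^esub> b)" using a I_sub by (simp add: subset_iff)
    then show "y \<oplus>\<^bsub>S\<^esub> z \<in> h ` I" using a b I.a_closed by blast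
  qed
  fix y z assume "y \<in> h ` I" and "z \<in> carrier S"
  then obtain a b where a: "a \<in> I" "y = h a" and b: "b \<in> carrier R" "z = h b"
    using surj by blast
  have "z \<otimes>\<^bsub>S\<^esub> y = h (b \<otimes>\<^bsub>R\<^esub> a)" "y \<otimes>\<^bsub>S\<^esub> z = h (a \<otimes>\<^bsub>R\<^esub> b)"
    using a b I_sub by (simp_all add: subset_iff)
  then show "z \<otimes>\<^bsub>S\<^esub> y \<in> h ` I" "y \<otimes>\<^bsub>S\<^esub> z \<in> h ` I"
    using I.I_l_closed[OF a(1) b(1)] I.I_r_closed[OF a(1) b(1)] by blast+
qed

text \<open>
  The preimage in the ring of holomorphic germs of the ideal \<^const>\<open>val_ideal\<close>. It is expressed by
  vanishing coefficients, which avoids the exceptional value of the subdegree at \<open>0\<close>.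
\<close>
definition order_ideal ::
  "('r \<Rightarrow> complex \<Rightarrow> complex^'n) \<Rightarrow> nat^'r \<Rightarrow> (complex^'n \<Rightarrow> complex) set" where
  "order_ideal \<nu> l = {f \<in> holo_at_0. \<forall>i. \<forall>k<l $ i. fps_nth (pull (\<nu> i) f) k = 0}"

definition value_jump :: "('r \<Rightarrow> complex \<Rightarrow> complex^'n) \<Rightarrow> nat^'r \<Rightarrow> 'r \<Rightarrow> bool" where
  "value_jump \<nu> l i \<longleftrightarrow> (\<exists>f\<in>order_ideal \<nu> l. fps_nth (pull (\<nu> i) f) (l $ i) \<noteq> 0)"

lemma enat_le_branch_val_iff:
  "enat n \<le> branch_val \<nu> g \<longleftrightarrow> (\<forall>k<n. fps_nth (germ_pullback \<nu> g) k = 0)"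
proof (cases "germ_pullback \<nu> g = 0")
  case False
  then show ?thesis
    by (auto simp: branch_val_def intro: subdegree_geI)
      (meson less_le_trans nth_less_subdegree_zero)
qed (simp add: branch_val_def)

lemma order_ideal_vertex:
  "f \<in> order_ideal \<nu> (vertex l {i}) \<longleftrightarrow>
     f \<in> order_ideal \<nu> l \<and> fps_nth (pull (\<nu> i) f) (l $ i) = 0"
  by (auto simp: order_ideal_def vertex_nth less_Suc_eq)

lemma order_ideal_antimono:
  assumes "\<And>i. l $ i \<le> m $ i"
  shows "order_ideal \<nu> m \<subseteq> order_ideal \<nu> l"
proof
  fix f assume f: "f \<in> order_ideal \<nu> m"
  have "fps_nth (pull (\<nu> i) f) k = 0" if "k < l $ i" for i k
    using f less_le_trans[OF that assms[of i]] by (simp add: order_ideal_def)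
  then show "f \<in> order_ideal \<nu> l" using f by (simp add: order_ideal_def)
qed

lemma fps_mult_low_order:
  fixes F G :: "complex fps"
  assumes "\<forall>k<m. fps_nth F k = 0" "\<forall>k<n. fps_nth G k = 0"
  shows "\<forall>k<m + n. fps_nth (F * G) k = 0"
    and "fps_nth (F * G) (m + n) = fps_nth F m * fps_nth G n"
proof -
  have zero: "fps_nth F i * fps_nth G (k - i) = 0" if "k < m + n \<or> k = m + n \<and> i \<noteq> m" "i \<le> k" for i k
  proof (cases "i < m")
    case False
    then have "k - i < n" using that by linarith
    then show ?thesis using assms by simp
  qed (use assms in simp)
  show "\<forall>k<m + n. fps_nth (F * G) k = 0"
  proof (intro allI impI)
    fix k assume "k < m + n"
    then show "fps_nth (F * G) k = 0"
      unfolding fps_mult_nth by (intro sum.neutral ballI zero) auto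
  qed
  have "fps_nth (F * G) (m + n) = (\<Sum>i\<in>{0..m + n}. fps_nth F i * fps_nth G (m + n - i))"
    by (rule fps_mult_nth)
  also have "\<dots> = (\<Sum>i\<in>{m}. fps_nth F i * fps_nth G (m + n - i))"
  proof (rule sum.mono_neutral_right)
    show "\<forall>i\<in>{0..m + n} - {m}. fps_nth F i * fps_nth G (m + n - i) = 0"
      by (intro ballI zero) auto
  qed auto
  finally show "fps_nth (F * G) (m + n) = fps_nth F m * fps_nth G n" by simp
qed

text \<open>
  Lattice paths by unit steps, given by the list of their directions, and the number of jumps met
  on the way.
\<close>
primrec walk :: "nat^'r \<Rightarrow> 'r list \<Rightarrow> nat^'r" where
  "walk l [] = l"
| "walk l (i # is) = walk (vertex l {i}) is"

primrec jump_count :: "(nat^'r \<Rightarrow> 'r \<Rightarrow> bool) \<Rightarrow> nat^'r \<Rightarrow> 'r list \<Rightarrow> nat" where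
  "jump_count J l [] = 0"
| "jump_count J l (i # is) = (if J l i then 1 else 0) + jump_count J (vertex l {i}) is"

lemma walk_append: "walk l (is @ js) = walk (walk l is) js"
  by (induction "is" arbitrary: l) auto

lemma jump_count_append:
  "jump_count J l (is @ js) = jump_count J l is + jump_count J (walk l is) js"
  by (induction "is" arbitrary: l) auto

lemma walk_ge: "l $ j \<le> walk l is $ j"
proof (induction "is" arbitrary: l)
  case (Cons i "is")
  have "l $ j \<le> vertex l {i} $ j" by (simp add: vertex_nth)
  then show ?case using Cons[of "vertex l {i}"] by simp
qed simp

lemma walk_exists: "\<exists>is. walk 0 is = l"
proof (induction l rule: lattice_point_induct)
  case zero
  show ?case by (intro exI[of _ "[]"]) simp
next
  case (step l i)
  then obtain "is" where "walk 0 is = l" by blast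
  then have "walk 0 (is @ [i]) = vertex l {i}" by (simp add: walk_append)
  then show ?case by blast
qed

locale arcs =
  fixes C :: "(complex^'n) set" and \<nu> :: "'r::finite \<Rightarrow> complex \<Rightarrow> complex^'n"
  assumes arc: "analytic_arc C (\<nu> i)"
begin

lemma order_ideal_add:
  "f \<in> order_ideal \<nu> l \<Longrightarrow> g \<in> order_ideal \<nu> l \<Longrightarrow> (\<lambda>x. f x + g x) \<in> order_ideal \<nu> l"
  by (auto simp: order_ideal_def holo_at_0_add pull_add[OF arc])

lemma order_ideal_mult:
  assumes "f \<in> order_ideal \<nu> l" "g \<in> order_ideal \<nu> m"
  shows "(\<lambda>x. f x * g x) \<in> order_ideal \<nu> (l + m)"
    and "fps_nth (pull (\<nu> i) (\<lambda>x. f x * g x)) (l $ i + m $ i) =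
         fps_nth (pull (\<nu> i) f) (l $ i) * fps_nth (pull (\<nu> i) g) (m $ i)"
proof -
  have fg: "f \<in> holo_at_0" "g \<in> holo_at_0" using assms by (auto simp: order_ideal_def)
  have low: "\<forall>k<l $ i. fps_nth (pull (\<nu> i) f) k = 0" "\<forall>k<m $ i. fps_nth (pull (\<nu> i) g) k = 0" for i
    using assms by (auto simp: order_ideal_def)
  show "(\<lambda>x. f x * g x) \<in> order_ideal \<nu> (l + m)"
    using fps_mult_low_order(1)[OF low] fg
    by (simp add: order_ideal_def holo_at_0_mult pull_mult[OF arc])
  show "fps_nth (pull (\<nu> i) (\<lambda>x. f x * g x)) (l $ i + m $ i) =
        fps_nth (pull (\<nu> i) f) (l $ i) * fps_nth (pull (\<nu> i) g) (m $ i)"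
    using fps_mult_low_order(2)[OF low] fg by (simp add: pull_mult[OF arc])
qed

lemma order_ideal_mult_holo:
  assumes "f \<in> order_ideal \<nu> l" "g \<in> holo_at_0"
  shows "(\<lambda>x. g x * f x) \<in> order_ideal \<nu> l"
proof -
  have "g \<in> order_ideal \<nu> 0" using assms(2) by (simp add: order_ideal_def)
  from order_ideal_mult(1)[OF this assms(1)] show ?thesis by simp
qed

lemma ideal_order_ideal: "ideal (order_ideal \<nu> l) holo_ring"
proof (rule idealI)
  show ring: "ring (holo_ring :: (complex^'n \<Rightarrow> complex) ring)"
    using cring_holo_ring by (rule cring.axioms(1))
  then interpret ring "holo_ring :: (complex^'n \<Rightarrow> complex) ring" .
  show "subgroup (order_ideal \<nu> l) (add_monoid holo_ring)"
  proof (rule add.subgroupI)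
    show "order_ideal \<nu> l \<subseteq> carrier holo_ring" by (auto simp: order_ideal_def)
    have "(\<lambda>x. 0) \<in> order_ideal \<nu> l" by (simp add: order_ideal_def holo_at_0_const pull_const)
    then show "order_ideal \<nu> l \<noteq> {}" by blast
    fix f assume f: "f \<in> order_ideal \<nu> l"
    then have fc: "f \<in> holo_at_0" by (simp add: order_ideal_def)
    have "\<ominus>\<^bsub>holo_ring\<^esub> f = (\<lambda>x. - f x)"
      using fc by (intro minus_equality) (auto simp: holo_at_0_uminus)
    then show "\<ominus>\<^bsub>holo_ring\<^esub> f \<in> order_ideal \<nu> l"
      using f by (simp add: order_ideal_def holo_at_0_uminus pull_uminus[OF arc])
    fix g assume "g \<in> order_ideal \<nu> l"
    with f show "f \<oplus>\<^bsub>holo_ring\<^esub> g \<in> order_ideal \<nu> l" by (simp add: order_ideal_add)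
  qed
  fix f g :: "complex^'n \<Rightarrow> complex"
  assume "f \<in> order_ideal \<nu> l" "g \<in> carrier holo_ring"
  then have *: "(\<lambda>x. g x * f x) \<in> order_ideal \<nu> l" by (simp add: order_ideal_mult_holo)
  then show "g \<otimes>\<^bsub>holo_ring\<^esub> f \<in> order_ideal \<nu> l" by simp
  have "(\<lambda>x. f x * g x) = (\<lambda>x. g x * f x)" by (simp add: mult.commute)
  with * show "f \<otimes>\<^bsub>holo_ring\<^esub> g \<in> order_ideal \<nu> l" by simp
qed

lemma restrict_germ_in_val_ideal_iff:
  assumes "f \<in> holo_at_0"
  shows "restrict_germ C f \<in> val_ideal C \<nu> l \<longleftrightarrow> f \<in> order_ideal \<nu> l"
  using assms by (auto simp: val_ideal_def carrier_local_ring enat_le_branch_val_iff order_ideal_def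
      germ_pullback_restrict[OF arc])

lemma ideal_val_ideal: "ideal (val_ideal C \<nu> l) (local_ring C)"
proof -
  interpret ring_hom_ring holo_ring "local_ring C" "restrict_germ C"
    by (rule restrict_germ_hom)
  have "val_ideal C \<nu> l \<subseteq> restrict_germ C ` holo_at_0"
    by (auto simp: val_ideal_def carrier_local_ring)
  then have "val_ideal C \<nu> l = restrict_germ C ` order_ideal \<nu> l"
    using restrict_germ_in_val_ideal_iff by (auto simp: order_ideal_def)
  then show ?thesis
    using image_ideal[OF ideal_order_ideal] by (simp add: carrier_local_ring)
qed

text \<open>
  The two successive quotients in the definition of \<^const>\<open>hilbert\<close> are treated as a single surjective
  homomorphism from the ring of holomorphic germs, with kernel \<open>order_ideal \<nu> l\<close>.
\<close>
definition quot :: "nat^'r \<Rightarrow> (complex^'n \<Rightarrow> complex) set set ring" where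
  "quot l = local_ring C Quot val_ideal C \<nu> l"

definition proj :: "nat^'r \<Rightarrow> (complex^'n \<Rightarrow> complex) \<Rightarrow> (complex^'n \<Rightarrow> complex) set set" where
  "proj l f = val_ideal C \<nu> l +>\<^bsub>local_ring C\<^esub> restrict_germ C f"

lemma proj_hom: "ring_hom_ring holo_ring (quot l) (proj l)"
proof (rule ring_hom_ringI2)
  interpret r: ring_hom_ring holo_ring "local_ring C" "restrict_germ C"
    by (rule restrict_germ_hom)
  interpret v: ideal "val_ideal C \<nu> l" "local_ring C" by (rule ideal_val_ideal)
  show "ring (holo_ring :: (complex^'n \<Rightarrow> complex) ring)" by (rule r.R.ring_axioms)
  show "ring (quot l)" unfolding quot_def by (rule v.quotient_is_ring)
  have "proj l = (+>\<^bsub>local_ring C\<^esub>) (val_ideal C \<nu> l) \<circ> restrict_germ C"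
    by (simp add: fun_eq_iff proj_def)
  then show "proj l \<in> ring_hom holo_ring (quot l)"
    unfolding quot_def using ring_hom_trans[OF r.homh v.rcos_ring_hom] by simp
qed

lemma proj_surj: "proj l ` holo_at_0 = carrier (quot l)"
  by (auto simp: quot_def proj_def FactRing_def A_RCOSETS_def' carrier_local_ring)

lemma proj_eq_zero_iff:
  assumes "f \<in> holo_at_0"
  shows "proj l f = \<zero>\<^bsub>quot l\<^esub> \<longleftrightarrow> f \<in> order_ideal \<nu> l"
proof -
  interpret ideal "val_ideal C \<nu> l" "local_ring C" by (rule ideal_val_ideal)
  have carr: "restrict_germ C f \<in> carrier (local_ring C)"
    using assms by (simp add: carrier_local_ring)
  have "proj l f = \<zero>\<^bsub>quot l\<^esub> \<longleftrightarrow> restrict_germ C f \<in> val_ideal C \<nu> l"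
    using a_coset_join1[OF _ carr a_subgroup] a_coset_join2[OF carr a_subgroup]
    by (auto simp: proj_def quot_def FactRing_def)
  then show ?thesis by (simp add: restrict_germ_in_val_ideal_iff[OF assms])
qed

lemma proj_eq_iff:
  assumes f: "f \<in> holo_at_0" and g: "g \<in> holo_at_0"
  shows "proj l f = proj l g \<longleftrightarrow> (\<lambda>x. f x - g x) \<in> order_ideal \<nu> l"
proof -
  interpret ring_hom_ring holo_ring "quot l" "proj l" by (rule proj_hom)
  have d: "(\<lambda>x. f x + - g x) \<in> holo_at_0"
    by (rule holo_at_0_add[OF f holo_at_0_uminus[OF g]])
  have "proj l f = proj l (\<lambda>x. (f x + - g x) + g x)" by simp
  also have "\<dots> = proj l (\<lambda>x. f x + - g x) \<oplus>\<^bsub>quot l\<^esub> proj l g"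
    using hom_add[of "\<lambda>x. f x + - g x" g] d g by simp
  finally have eq: "proj l f = proj l (\<lambda>x. f x + - g x) \<oplus>\<^bsub>quot l\<^esub> proj l g" .
  have carr: "proj l (\<lambda>x. f x + - g x) \<in> carrier (quot l)" "proj l g \<in> carrier (quot l)"
    using hom_closed d g by auto
  have "proj l f = proj l g \<longleftrightarrow> proj l (\<lambda>x. f x + - g x) = \<zero>\<^bsub>quot l\<^esub>"
    unfolding eq using carr by simp
  then show ?thesis using proj_eq_zero_iff[OF d] by simp
qed

text \<open>
  A path from \<open>0\<close> to \<open>l\<close> gives a flag of subspaces of the quotient at \<open>l\<close>. A step that is not a jump
  leaves the subspace unchanged; at a jump, a function of the exact order spans a complement, since a
  suitable multiple of it cancels the leading coefficient of any other function. Fixing the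
  quotient and moving the subspace avoids comparing different quotient rings.
\<close>
lemma dimension_order_ideal:
  assumes "walk x is = l"
  shows "ring.dimension (quot l) (jump_count (value_jump \<nu>) x is)
           (range (\<lambda>c. proj l (\<lambda>_. c))) (proj l ` order_ideal \<nu> x)"
  using assms
proof (induction "is" arbitrary: x)
  case Nil
  interpret ring_hom_ring holo_ring "quot l" "proj l" by (rule proj_hom)
  have "proj l f = \<zero>\<^bsub>quot l\<^esub>" if "f \<in> order_ideal \<nu> l" for f
    using that proj_eq_zero_iff[of f l] by (simp add: order_ideal_def)
  moreover have "(\<lambda>x. 0) \<in> order_ideal \<nu> l"
    by (simp add: order_ideal_def holo_at_0_const pull_const)
  ultimately have "proj l ` order_ideal \<nu> l = {\<zero>\<^bsub>quot l\<^esub>}" by force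
  then show ?case using Nil S.dimension.zero_dim by simp
next
  case (Cons i "is")
  interpret ring_hom_ring holo_ring "quot l" "proj l" by (rule proj_hom)
  let ?y = "vertex x {i}" and ?K = "range (\<lambda>c. proj l (\<lambda>_. c))"
  have y: "walk ?y is = l" using Cons.prems by simp
  have ly: "order_ideal \<nu> l \<subseteq> order_ideal \<nu> ?y"
    using walk_ge[of ?y _ "is"] y by (intro order_ideal_antimono) auto
  show ?case
  proof (cases "value_jump \<nu> x i")
    case False
    then have "order_ideal \<nu> ?y = order_ideal \<nu> x"
      by (auto simp: order_ideal_vertex value_jump_def)
    then show ?thesis using Cons.IH[OF y] False by simp
  next
    case True
    then obtain f where f: "f \<in> order_ideal \<nu> x" "fps_nth (pull (\<nu> i) f) (x $ i) \<noteq> 0"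
      by (auto simp: value_jump_def)
    have fh: "f \<in> holo_at_0" using f by (simp add: order_ideal_def)
    have "proj l f \<notin> proj l ` order_ideal \<nu> ?y"
    proof
      assume "proj l f \<in> proj l ` order_ideal \<nu> ?y"
      then obtain g where g: "g \<in> order_ideal \<nu> ?y" "proj l f = proj l g" by blast
      then have "(\<lambda>x. f x - g x) \<in> order_ideal \<nu> ?y"
        using proj_eq_iff[OF fh, of g l] ly by (auto simp: order_ideal_def)
      then have "(\<lambda>x. (f x - g x) + g x) \<in> order_ideal \<nu> ?y"
        using g(1) by (rule order_ideal_add)
      then show False using f(2) by (simp add: order_ideal_vertex)
    qed
    then have dim: "S.dimension (Suc (jump_count (value_jump \<nu>) ?y is)) ?K
                 (S.line_extension ?K (proj l f) (proj l ` order_ideal \<nu> ?y))"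
      using Cons.IH[OF y] hom_closed[of f] fh by (intro S.dimension.Suc_dim) auto
    have comb: "proj l (\<lambda>_. c) \<otimes>\<^bsub>quot l\<^esub> proj l f \<oplus>\<^bsub>quot l\<^esub> proj l g = proj l (\<lambda>x. c * f x + g x)"
      if "g \<in> holo_at_0" for c g
      using hom_mult[of "\<lambda>_. c" f] hom_add[of "\<lambda>x. c * f x" g] that fh
      by (simp add: holo_at_0_const holo_at_0_mult)
    have "S.line_extension ?K (proj l f) (proj l ` order_ideal \<nu> ?y) = proj l ` order_ideal \<nu> x"
    proof (intro equalityI subsetI)
      fix u assume "u \<in> S.line_extension ?K (proj l f) (proj l ` order_ideal \<nu> ?y)"
      then obtain c g where g: "g \<in> order_ideal \<nu> ?y"
        and u: "u = proj l (\<lambda>_. c) \<otimes>\<^bsub>quot l\<^esub> proj l f \<oplus>\<^bsub>quot l\<^esub> proj l g"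
        by (auto simp: S.line_extension_mem_iff)
      have "g \<in> order_ideal \<nu> x" using g by (simp add: order_ideal_vertex)
      moreover have "u = proj l (\<lambda>x. c * f x + g x)"
        unfolding u using g by (intro comb) (simp add: order_ideal_def)
      ultimately show "u \<in> proj l ` order_ideal \<nu> x"
        using order_ideal_add[OF order_ideal_mult_holo[OF f(1) holo_at_0_const[of c]]] by blast
    next
      fix u assume "u \<in> proj l ` order_ideal \<nu> x"
      then obtain g where g: "g \<in> order_ideal \<nu> x" "u = proj l g" by blast
      define c where "c = - fps_nth (pull (\<nu> i) g) (x $ i) / fps_nth (pull (\<nu> i) f) (x $ i)"
      define h where "h = (\<lambda>x. g x + c * f x)"
      have cf: "(\<lambda>x. c * f x) \<in> order_ideal \<nu> x"
        by (rule order_ideal_mult_holo[OF f(1) holo_at_0_const])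
      have gh: "g \<in> holo_at_0" using g by (simp add: order_ideal_def)
      have "pull (\<nu> i) h = pull (\<nu> i) g + fps_const c * pull (\<nu> i) f"
        unfolding h_def using cf gh fh
        by (simp add: pull_add[OF arc] pull_mult[OF arc] pull_const holo_at_0_const order_ideal_def)
      then have "fps_nth (pull (\<nu> i) h) (x $ i) = 0"
        using f(2) by (simp add: c_def)
      moreover have "h \<in> order_ideal \<nu> x"
        unfolding h_def using g(1) cf by (rule order_ideal_add)
      ultimately have h: "h \<in> order_ideal \<nu> ?y" by (simp add: order_ideal_vertex)
      have "u = proj l (\<lambda>x. - c * f x + h x)" by (simp add: g(2) h_def)
      also have "\<dots> = proj l (\<lambda>_. - c) \<otimes>\<^bsub>quot l\<^esub> proj l f \<oplus>\<^bsub>quot l\<^esub> proj l h"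
        using h by (intro comb[symmetric]) (simp add: order_ideal_def)
      finally show "u \<in> S.line_extension ?K (proj l f) (proj l ` order_ideal \<nu> ?y)"
        using h unfolding S.line_extension_mem_iff by blast
    qed
    then show ?thesis using dim True by simp
  qed
qed

text \<open>
  At \<open>l = 0\<close> the quotient is the zero ring and the image of the constants is not a field; the
  dimension is then determined directly.
\<close>
lemma hilbert_eq_jump_count:
  assumes "walk 0 is = l"
  shows "hilbert C \<nu> l = jump_count (value_jump \<nu>) 0 is"
proof -
  interpret ring_hom_ring holo_ring "quot l" "proj l" by (rule proj_hom)
  let ?K = "range (\<lambda>c. proj l (\<lambda>_. c))"
  have hilbert: "hilbert C \<nu> l = S.dim ?K (carrier (quot l))"
    by (simp add: hilbert_def Let_def quot_def proj_def)
  have "proj l ` order_ideal \<nu> 0 = carrier (quot l)"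
    using proj_surj by (simp add: order_ideal_def)
  with dimension_order_ideal[OF assms]
  have dim: "S.dimension (jump_count (value_jump \<nu>) 0 is) ?K (carrier (quot l))"
    by simp
  show ?thesis
  proof (cases "\<one>\<^bsub>quot l\<^esub> = \<zero>\<^bsub>quot l\<^esub>")
    case False
    have "?K = proj l ` range (\<lambda>c x. c)" by auto
    then have "subfield ?K (quot l)"
      using img_is_subfield(2)[OF subfield_constants False] by simp
    from S.dimI[OF this dim] show ?thesis by (simp add: hilbert over_def)
  next
    case True
    then have triv: "carrier (quot l) = {\<zero>\<^bsub>quot l\<^esub>}" by (simp add: S.one_zeroD)
    have "n = 0 \<and> E = {\<zero>\<^bsub>quot l\<^esub>}" if "S.dimension n ?K E" for n E
      using that
    proof (induction n "?K" E rule: S.dimension.induct)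
      case (Suc_dim v E n)
      then show ?case using triv by simp
    qed simp
    then have zero: "n = 0" if "S.dimension n ?K (carrier (quot l))" for n
      using that by blast
    show ?thesis
      unfolding hilbert S.dim_def
    proof (rule the_equality)
      show "S.dimension (jump_count (value_jump \<nu>) 0 is) ?K (carrier (quot l))" by (rule dim)
      fix n assume "S.dimension n ?K (carrier (quot l))"
      then show "n = jump_count (value_jump \<nu>) 0 is" using zero[OF dim] zero by simp
    qed
  qed
qed

lemma weight_0: "weight C \<nu> 0 = 0"
  using hilbert_eq_jump_count[of "[]" 0] by (simp add: weight_def)

lemma weight_vertex:
  "weight C \<nu> (vertex l {i}) = weight C \<nu> l + (if value_jump \<nu> l i then 1 else - 1)"
proof -
  obtain "is" where "is": "walk 0 is = l" using walk_exists by blast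
  then have "walk 0 (is @ [i]) = vertex l {i}" by (simp add: walk_append)
  from hilbert_eq_jump_count[OF this] hilbert_eq_jump_count[OF "is"]
  have "hilbert C \<nu> (vertex l {i}) = hilbert C \<nu> l + (if value_jump \<nu> l i then 1 else 0)"
    by (simp add: jump_count_append "is")
  moreover have "(\<Sum>j\<in>UNIV. vertex l {i} $ j) = Suc (\<Sum>j\<in>UNIV. l $ j)"
    by (simp add: vertex_nth sum.distrib)
  ultimately show ?thesis by (simp add: weight_def)
qed

lemma value_jump_antimono:
  assumes "value_jump \<nu> x i" "\<And>j. y $ j \<le> x $ j" "y $ i = x $ i"
  shows "value_jump \<nu> y i"
  using assms order_ideal_antimono[OF assms(2)] by (auto simp: value_jump_def)

lemma value_jump_add:
  assumes "value_jump \<nu> x i" "value_jump \<nu> y i"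
  shows "value_jump \<nu> (x + y) i"
proof -
  from assms obtain f g where f: "f \<in> order_ideal \<nu> x" "fps_nth (pull (\<nu> i) f) (x $ i) \<noteq> 0"
    and g: "g \<in> order_ideal \<nu> y" "fps_nth (pull (\<nu> i) g) (y $ i) \<noteq> 0"
    by (auto simp: value_jump_def)
  then show ?thesis
    unfolding value_jump_def using order_ideal_mult[OF f(1) g(1)]
    by (intro bexI[of _ "\<lambda>x. f x * g x"]) auto
qed

text \<open>
  All branches pass through the origin: the value of \<open>f\<close> there is the constant
  coefficient of its pullback to every branch.
\<close>
lemma not_value_jump_local:
  assumes "x $ i = 0" "0 < x $ j"
  shows "\<not> value_jump \<nu> x i"
proof
  assume "value_jump \<nu> x i"
  then obtain f where f: "f \<in> order_ideal \<nu> x" "fps_nth (pull (\<nu> i) f) 0 \<noteq> 0"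
    using assms(1) by (auto simp: value_jump_def)
  then have "f \<in> holo_at_0" "fps_nth (pull (\<nu> j) f) 0 = 0"
    using assms(2) by (auto simp: order_ideal_def)
  then show False using f(2) by (simp add: pull_nth_0[OF arc])
qed

end

lemma sublevel_eq_cube_complex: "sublevel C \<nu> n = cube_complex {l. weight C \<nu> l \<le> n}"
proof -
  have "cube_weight C \<nu> l I \<le> n \<longleftrightarrow> (\<forall>K\<subseteq>I. weight C \<nu> (vertex l K) \<le> n)" for l I
  proof -
    have "Pow I \<noteq> {}" by blast
    then show ?thesis by (simp add: cube_weight_def) blast
  qed
  then show ?thesis by (simp add: sublevel_def cube_complex_def)
qed

section \<open>The conductor and the main theorem\<close>

lemma analytic_germ_separate:
  assumes "analytic_germ Y" "\<not> germ_le X Y"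
  obtains f where "f \<in> holo_at_0" "\<forall>\<^sub>F x in nhds 0. x \<in> Y \<longrightarrow> f x = 0"
    "\<not> (\<forall>\<^sub>F x in nhds 0. x \<in> X \<longrightarrow> f x = 0)"
proof -
  from assms(1) obtain U F where U: "open U" "0 \<in> U" and F: "finite F" "\<forall>f\<in>F. mholomorphic_on f U"
    and Y: "Y \<inter> U = {x \<in> U. \<forall>f\<in>F. f x = 0}"
    unfolding analytic_germ_def by blast
  have in_U: "\<forall>\<^sub>F x in nhds 0. x \<in> U"
    using U by (rule eventually_nhds_in_open)
  have "\<exists>f\<in>F. \<not> (\<forall>\<^sub>F x in nhds 0. x \<in> X \<longrightarrow> f x = 0)"
  proof (rule ccontr)
    assume "\<not> (\<exists>f\<in>F. \<not> (\<forall>\<^sub>F x in nhds 0. x \<in> X \<longrightarrow> f x = 0))"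
    then have "\<forall>\<^sub>F x in nhds 0. \<forall>f\<in>F. x \<in> X \<longrightarrow> f x = 0"
      using F(1) by (intro eventually_ball_finite) auto
    with in_U have "\<forall>\<^sub>F x in nhds 0. x \<in> X \<longrightarrow> x \<in> Y"
      by eventually_elim (use Y in blast)
    then show False using assms(2) by (simp add: germ_le_def)
  qed
  then obtain f where f: "f \<in> F" "\<not> (\<forall>\<^sub>F x in nhds 0. x \<in> X \<longrightarrow> f x = 0)" by blast
  have "f \<in> holo_at_0" using f(1) F(2) U unfolding holo_at_0_def by blast
  moreover have "\<forall>\<^sub>F x in nhds 0. x \<in> Y \<longrightarrow> f x = 0"
    using in_U by eventually_elim (use Y f(1) in blast)
  ultimately show ?thesis using f(2) by (rule that)
qed

text \<open>
  The numerical semigroup generated by \<open>m\<close> and \<open>m + 1\<close> contains everything from \<open>m\<^sup>2\<close> on: divide by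
  \<open>m\<close> and replace as many summands \<open>m\<close> by \<open>m + 1\<close> as the remainder demands.
\<close>
lemma sum_of_consecutive_multiples:
  fixes m N :: nat
  assumes "m * m \<le> N"
  obtains u v where "N = u * Suc m + v * m"
proof (cases "m = 0")
  case True
  then show ?thesis using that[of N 0] by simp
next
  case False
  have "m \<le> N div m" using assms False by (simp add: less_eq_div_iff_mult_less_eq)
  then have le: "N mod m \<le> N div m"
    using False by (meson le_trans less_imp_le mod_less_divisor neq0_conv)
  have "N = N div m * m + N mod m" by simp
  also have "\<dots> = (N mod m + (N div m - N mod m)) * m + N mod m" using le by simp
  also have "\<dots> = N mod m * Suc m + (N div m - N mod m) * m"
    by (simp add: distrib_right)
  finally show ?thesis by (rule that)
qed

text \<open>A product of functions, each vanishing on one of the other branches but not on the branch \<open>i\<close>.\<close>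
lemma branch_separating_function:
  fixes B :: "'r \<Rightarrow> (complex^'n) set" and \<nu> :: "'r \<Rightarrow> complex \<Rightarrow> complex^'n"
  assumes norm: "\<And>j. is_normalization (B j) (\<nu> j)" and an: "\<And>j. analytic_germ (B j)"
    and ne: "\<And>j. i \<noteq> j \<Longrightarrow> \<not> germ_le (B i) (B j)"
    and J: "finite J" "i \<notin> J"
  shows "\<exists>g\<in>holo_at_0. pull (\<nu> i) g \<noteq> 0 \<and> (\<forall>j\<in>J. pull (\<nu> j) g = 0)"
  using J
proof (induction J rule: finite_induct)
  case empty
  show ?case
    by (intro bexI[of _ "\<lambda>x. 1"]) (auto simp: pull_const holo_at_0_const)
next
  case (insert j J)
  note arc = is_normalization_arc[OF norm]
  from insert obtain g where g: "g \<in> holo_at_0" "pull (\<nu> i) g \<noteq> 0" "\<forall>j\<in>J. pull (\<nu> j) g = 0"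
    by auto
  obtain f where f: "f \<in> holo_at_0" "\<forall>\<^sub>F x in nhds 0. x \<in> B j \<longrightarrow> f x = 0"
    "\<not> (\<forall>\<^sub>F x in nhds 0. x \<in> B i \<longrightarrow> f x = 0)"
    using analytic_germ_separate[OF an ne] insert.prems by blast
  have "pull (\<nu> j) f = 0" "pull (\<nu> i) f \<noteq> 0"
    using f normalization_pull_eq_0_iff[OF norm] by auto
  then show ?case
    using f(1) g
    by (intro bexI[of _ "\<lambda>x. f x * g x"]) (auto simp: pull_mult[OF arc] holo_at_0_mult)
qed

text \<open>
  A function \<open>g\<close> that vanishes on all branches but the \<open>i\<close>-th has infinite order on those. Multiplying
  it by \<open>a\<^sup>u b\<^sup>v\<close>, where \<open>a\<close> and \<open>b\<close> have consecutive orders on the branch \<open>i\<close>, realizes all large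
  orders there while keeping infinite order on the other branches.
\<close>
lemma value_jump_conductor:
  fixes B :: "'r::finite \<Rightarrow> (complex^'n) set" and \<nu> :: "'r \<Rightarrow> complex \<Rightarrow> complex^'n"
  assumes norm: "\<And>j. is_normalization (B j) (\<nu> j)" and an: "\<And>j. analytic_germ (B j)"
    and ne: "\<And>i j. i \<noteq> j \<Longrightarrow> \<not> germ_le (B i) (B j)"
  shows "\<exists>c. \<forall>x. c \<le> x $ i \<longrightarrow> value_jump \<nu> x i"
proof -
  note arc = is_normalization_arc[OF norm]
  obtain g where g: "g \<in> holo_at_0" "pull (\<nu> i) g \<noteq> 0" "\<And>j. j \<noteq> i \<Longrightarrow> pull (\<nu> j) g = 0"
    using branch_separating_function[where B = B and \<nu> = \<nu> and i = i and J = "UNIV - {i}", OF norm an ne]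
    by auto
  obtain a b where a: "a \<in> holo_at_0" "pull (\<nu> i) a \<noteq> 0" and b: "b \<in> holo_at_0" "pull (\<nu> i) b \<noteq> 0"
    and ab: "subdegree (pull (\<nu> i) a) = Suc (subdegree (pull (\<nu> i) b))"
    using normalization_consecutive_orders[OF norm] by blast
  define m where "m = subdegree (pull (\<nu> i) b)"
  define s where "s = subdegree (pull (\<nu> i) g)"
  have "value_jump \<nu> x i" if "m * m + s \<le> x $ i" for x
  proof -
    from that have "m * m \<le> x $ i - s" by simp
    then obtain u v where uv: "x $ i - s = u * Suc m + v * m"
      by (rule sum_of_consecutive_multiples)
    define f where "f = (\<lambda>x. g x * (a x ^ u * b x ^ v))"
    have h: "(\<lambda>x. a x ^ u * b x ^ v) \<in> holo_at_0"
      using a b by (intro holo_at_0_mult holo_at_0_power)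
    have f: "f \<in> holo_at_0" unfolding f_def using g(1) h by (rule holo_at_0_mult)
    have prod: "pull (\<nu> j) f = pull (\<nu> j) g * (pull (\<nu> j) a ^ u * pull (\<nu> j) b ^ v)" for j
      unfolding f_def using g(1) h a(1) b(1)
      by (simp add: pull_mult[OF arc] pull_power[OF arc] holo_at_0_power)
    have pf0: "pull (\<nu> j) f = 0" if "j \<noteq> i" for j
      using g(3)[OF that] by (simp add: prod)
    have pf: "pull (\<nu> i) f \<noteq> 0"
      using g(2) a(2) b(2) by (simp add: prod)
    have "subdegree (pull (\<nu> i) f) = s + (u * Suc m + v * m)"
      using g(2) a(2) b(2) by (simp add: prod ab s_def m_def subdegree_power)
    then have deg: "subdegree (pull (\<nu> i) f) = x $ i"
      using uv that by simp
    have "fps_nth (pull (\<nu> j) f) k = 0" if "k < x $ j" for j k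
      using that pf0[of j] deg nth_less_subdegree_zero[of k "pull (\<nu> i) f"] by (cases "j = i") auto
    then have "f \<in> order_ideal \<nu> x" using f by (simp add: order_ideal_def)
    moreover have "fps_nth (pull (\<nu> i) f) (x $ i) \<noteq> 0"
      using pf nth_subdegree_nonzero[of "pull (\<nu> i) f"] by (simp add: deg)
    ultimately show ?thesis by (auto simp: value_jump_def)
  qed
  then show ?thesis by blast
qed

lemma jump_weight_curve:
  fixes C :: "(complex^'n) set" and B :: "'r::finite \<Rightarrow> (complex^'n) set"
    and \<nu> :: "'r \<Rightarrow> complex \<Rightarrow> complex^'n"
  assumes dec: "irreducible_decomposition C B" and norm: "\<And>i. is_normalization (B i) (\<nu> i)"
  shows "jump_weight (weight C \<nu>) (value_jump \<nu>)"
proof -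
  have an: "analytic_germ (B j)" for j
    using dec by (simp add: irreducible_decomposition_def irreducible_germ_def)
  have ne: "\<not> germ_le (B i) (B j)" if "i \<noteq> j" for i j
    using dec that by (simp add: irreducible_decomposition_def)
  interpret arcs C \<nu>
  proof
    fix i
    have arc: "analytic_arc (B i) (\<nu> i)" by (rule is_normalization_arc[OF norm])
    have "\<forall>\<^sub>F x in nhds 0. x \<in> C \<longleftrightarrow> x \<in> (\<Union>i. B i)"
      using dec by (simp add: irreducible_decomposition_def germ_eq_def)
    then have "\<forall>\<^sub>F x in nhds 0. x \<in> B i \<longrightarrow> x \<in> C"
      by eventually_elim blast
    then have "\<forall>\<^sub>F t in nhds 0. \<nu> i t \<in> B i \<longrightarrow> \<nu> i t \<in> C"
      using analytic_arc_tendsto[OF arc] by (auto simp: filterlim_iff)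
    moreover have "\<forall>\<^sub>F t in nhds 0. \<nu> i t \<in> B i" using arc by (simp add: analytic_arc_def)
    ultimately have "\<forall>\<^sub>F t in nhds 0. \<nu> i t \<in> C" by eventually_elim simp
    then show "analytic_arc C (\<nu> i)" using arc by (simp add: analytic_arc_def)
  qed
  show ?thesis
  proof
    have "\<forall>i. \<exists>c. \<forall>x. c \<le> x $ i \<longrightarrow> value_jump \<nu> x i"
      using value_jump_conductor[where B = B and \<nu> = \<nu>, OF norm an ne] by blast
    then obtain c where c: "\<And>i x. c i \<le> x $ i \<Longrightarrow> value_jump \<nu> x i" by metis
    then show "\<exists>c :: nat^'r. \<forall>x i. c $ i \<le> x $ i \<longrightarrow> value_jump \<nu> x i"
      by (intro exI[of _ "\<chi> i. c i"]) simp
  qed (use weight_0 weight_vertex value_jump_antimono value_jump_add not_value_jump_local in blast)+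
qed

theorem theorem1p3p1:
  fixes C :: "(complex^'n) set"
    and B :: "'r::finite \<Rightarrow> (complex^'n) set"
    and \<nu> :: "'r \<Rightarrow> complex \<Rightarrow> complex^'n"
  assumes "reduced_curve_germ C"
    and "irreducible_decomposition C B"
    and "\<And>i. is_normalization (B i) (\<nu> i)"
  shows "(\<forall>n>0. sublevel C \<nu> n \<noteq> {} \<and> contractible (sublevel C \<nu> n)) \<and>
         (\<forall>n>0. \<forall>q. trivial_group (reduced_lattice_cohomology C \<nu> q n))"
proof -
  interpret jump_weight "weight C \<nu>" "value_jump \<nu>"
    using assms(2,3) by (rule jump_weight_curve)
  have contr: "contractible (sublevel C \<nu> n)" if "0 < n" for n
    unfolding sublevel_eq_cube_complex
  proof (rule contractible_cube_complex)
    show "finite {l. weight C \<nu> l \<le> n}" by (rule finite_sublevel)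
    show "0 \<in> {l. weight C \<nu> l \<le> n}" using that by (simp add: w_0)
    fix p assume "p \<in> {l. weight C \<nu> l \<le> n}" "p \<noteq> 0"
    then show "\<exists>i. 0 < p $ i \<and> (\<forall>K. i \<notin> K \<longrightarrow> (\<forall>j\<in>K. 0 < p $ j) \<longrightarrow>
        descend p K \<in> {l. weight C \<nu> l \<le> n} \<longrightarrow> descend p (insert i K) \<in> {l. weight C \<nu> l \<le> n})"
      using descending_cone[OF that] by simp
  qed
  have ne: "sublevel C \<nu> n \<noteq> {}" if "0 < n" for n
  proof -
    have "0 \<in> cube (0 :: nat^'r) {}" by (simp add: mem_cube_iff)
    moreover have "\<forall>K\<subseteq>{}. vertex 0 K \<in> {l. weight C \<nu> l \<le> n}" using that by (simp add: w_0)
    ultimately have "0 \<in> cube_complex {l. weight C \<nu> l \<le> n}"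
      unfolding cube_complex_def by blast
    then show ?thesis by (auto simp: sublevel_eq_cube_complex)
  qed
  have "trivial_group (reduced_lattice_cohomology C \<nu> q n)" if "0 < n" for q n
    unfolding reduced_lattice_cohomology_def
    using contr[OF that] ne[OF that] by (intro trivial_reduced_cohomology_contractible) auto
  with contr ne show ?thesis by blast
qed

end
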